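(* Let $X$ be a uniformly locally finite metric space, let $(n_k)_{k\in\mathbb{N}}$ be a sequence of natural numbers that converges to infinity, let $\mathcal{M}:=\prod_k\mathrm{M}_{n_k}(\mathbb{C})$, and let $\Phi:\mathcal{M}\to\mathrm{C}^*_{ql}(X)$ be a normal $*$-homomorphic embedding. Let $S:=\{(i,k)\in\mathbb{N}\times\mathbb{N}: 1\le i\le n_k\}$. For each $s=(i,k)\in S$, let $e^k_{i,i}$ be the corresponding diagonal matrix unit in $\mathrm{M}_{n_k}(\mathbb{C})$ and define $q_s:=\Phi(e^k_{i,i})$. Then $(q_s)_{s\in S}$ is asymptotically a ghost.
   Context: A metric space $X$ is uniformly locally finite if for each $r>0$ one has $\sup_{x\in X}|B_r(x)|<\infty$, where $B_r(x)$ is the closed ball of radius $r$. $\ell_2(X)$ is the complex Hilbert space of square-summable functions on $X$ with orthonormal basis $(\delta_x)_{x\in X}$; for $A\subseteq X$, $\chi_A$ is the orthogonal projection onto $\ell_2(A)$; $d(A,B)=\inf\{d(x,y): x\in A, y\in B\}$. The quasi-local algebra $\mathrm{C}^*_{ql}(X)$ is the $\mathrm{C}^*$-algebra of all $a\in\mathcal{B}(\ell_2(X))$ such that for every $\varepsilon>0$ there is $r>0$ such that for all $A,B\subseteq X$ with $d(A,B)>r$ one has $\|\chi_A a\chi_B\|\le\varepsilon$. $\prod_k$ denotes the $\ell_\infty$-direct sum; $\mathrm{M}_{n_k}(\mathbb{C})$ is viewed as the $k$-th summand of $\mathcal{M}$. A normal embedding is an injective (not necessarily unital) $*$-homomorphism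 $\Phi:\mathcal{M}\to\mathrm{C}^*_{ql}(X)$ which is normal as a map into $\mathcal{B}(\ell_2(X))$, i.e. $\Phi(\sup_i a_i)=\sup_i\Phi(a_i)$ for every bounded increasing net $(a_i)$ of positive elements of $\mathcal{M}$. An orthogonal family of projections $(q_s)_{s\in S}$ on $\ell_2(X)$ is asymptotically a ghost if for all $\varepsilon>0$ there are finite subsets $F\subseteq X$ and $T\subseteq S$ such that $\left\|\sum_{s\in S\setminus T}q_s\delta_x\right\|<\varepsilon$ for all $x\in X\setminus F$. *)

theory Defs
  imports
    "HOL-Analysis.Bounded_Linear_Function"
    "HOL-Analysis.Infinite_Sum"
    "HOL-Analysis.L2_Norm"
    "Jordan_Normal_Form.Schur_Decomposition"
begin

section \<open>The complex Hilbert space of square-summable functions\<close>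

typedef 'a ell2 = "{f :: 'a \<Rightarrow> complex. (\<lambda>x. (cmod (f x))\<^sup>2) summable_on UNIV}"
  morphisms ell2_apply Abs_ell2
  by (rule exI[of _ "\<lambda>_. 0"]) simp

setup_lifting type_definition_ell2

lemma ell2_summable: "(\<lambda>x. (cmod (ell2_apply f x))\<^sup>2) summable_on A"
proof -
  have "(\<lambda>x. (cmod (ell2_apply f x))\<^sup>2) summable_on UNIV"
    using ell2_apply[of f] by simp
  then show ?thesis
    by (rule summable_on_subset_banach) simp
qed

lemma ell2_eqI: "(\<And>x. ell2_apply f x = ell2_apply g x) \<Longrightarrow> f = g"
  by transfer auto

lemma cmod_add_sq_le: "(cmod (a + b))\<^sup>2 \<le> 2 * (cmod a)\<^sup>2 + 2 * (cmod b)\<^sup>2"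
proof -
  have "(cmod (a + b))\<^sup>2 \<le> (cmod a + cmod b)\<^sup>2"
    by (intro power_mono norm_triangle_ineq) simp
  also have "\<dots> \<le> 2 * (cmod a)\<^sup>2 + 2 * (cmod b)\<^sup>2"
    using sum_squares_bound[of "cmod a" "cmod b"] by (simp add: power2_sum)
  finally show ?thesis .
qed

lemma sq_summable_add:
  assumes "(\<lambda>x. (cmod (f x))\<^sup>2) summable_on A" "(\<lambda>x. (cmod (g x))\<^sup>2) summable_on A"
  shows "(\<lambda>x. (cmod (f x + g x))\<^sup>2) summable_on A"
proof (rule summable_on_comparison_test)
  show "(\<lambda>x. 2 * (cmod (f x))\<^sup>2 + 2 * (cmod (g x))\<^sup>2) summable_on A"
    by (intro summable_on_add summable_on_cmult_right assms)
qed (auto simp: cmod_add_sq_le)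

instantiation ell2 :: (type) real_vector
begin
lift_definition zero_ell2 :: "'a ell2" is "\<lambda>_. 0" by simp
lift_definition plus_ell2 :: "'a ell2 \<Rightarrow> 'a ell2 \<Rightarrow> 'a ell2" is "\<lambda>f g x. f x + g x"
  by (rule sq_summable_add)
lift_definition uminus_ell2 :: "'a ell2 \<Rightarrow> 'a ell2" is "\<lambda>f x. - f x" by simp
lift_definition minus_ell2 :: "'a ell2 \<Rightarrow> 'a ell2 \<Rightarrow> 'a ell2" is "\<lambda>f g x. f x - g x"
proof -
  fix f g :: "'a \<Rightarrow> complex"
  assume "(\<lambda>x. (cmod (f x))\<^sup>2) summable_on UNIV" "(\<lambda>x. (cmod (g x))\<^sup>2) summable_on UNIV"
  then show "(\<lambda>x. (cmod (f x - g x))\<^sup>2) summable_on UNIV"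
    using sq_summable_add[of f UNIV "\<lambda>x. - g x"] by simp
qed
lift_definition scaleR_ell2 :: "real \<Rightarrow> 'a ell2 \<Rightarrow> 'a ell2" is "\<lambda>c f x. c *\<^sub>R f x"
  by (simp add: power_mult_distrib summable_on_cmult_right)
instance
  by standard (transfer, simp add: algebra_simps)+
end

lift_definition scaleC :: "complex \<Rightarrow> 'a ell2 \<Rightarrow> 'a ell2" (infixr "*\<^sub>C" 75)
  is "\<lambda>c f x. c * f x"
  by (simp add: norm_mult power_mult_distrib summable_on_cmult_right)

text \<open>The inner product is linear in the first argument.\<close>

definition cinner :: "'a ell2 \<Rightarrow> 'a ell2 \<Rightarrow> complex" where
  "cinner f g = (\<Sum>\<^sub>\<infinity>x. ell2_apply f x * cnj (ell2_apply g x))"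

lemma cinner_summable: "(\<lambda>x. ell2_apply f x * cnj (ell2_apply g x)) summable_on A"
proof (rule abs_summable_summable, rule summable_on_comparison_test)
  show "(\<lambda>x. (cmod (ell2_apply f x))\<^sup>2 + (cmod (ell2_apply g x))\<^sup>2) summable_on A"
    by (intro summable_on_add ell2_summable)
  fix x
  have "0 \<le> cmod (ell2_apply f x) * cmod (ell2_apply g x)" by simp
  then show "norm (ell2_apply f x * cnj (ell2_apply g x))
      \<le> (cmod (ell2_apply f x))\<^sup>2 + (cmod (ell2_apply g x))\<^sup>2"
    using sum_squares_bound[of "cmod (ell2_apply f x)" "cmod (ell2_apply g x)"]
    unfolding norm_mult complex_mod_cnj by linarith
qed simp

lemma cinner_self: "cinner f f = of_real (\<Sum>\<^sub>\<infinity>x. (cmod (ell2_apply f x))\<^sup>2)"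
proof -
  have "cinner f f = (\<Sum>\<^sub>\<infinity>x. of_real ((cmod (ell2_apply f x))\<^sup>2))"
    unfolding cinner_def complex_norm_square ..
  also have "\<dots> = of_real (\<Sum>\<^sub>\<infinity>x. (cmod (ell2_apply f x))\<^sup>2)"
    by (intro infsumI has_sum_of_real has_sum_infsum ell2_summable)
  finally show ?thesis .
qed

lemma cinner_add_left: "cinner (f + g) h = cinner f h + cinner g h"
  unfolding cinner_def plus_ell2.rep_eq distrib_right
  by (intro infsum_add cinner_summable)

lemma cinner_scaleC_left: "cinner (c *\<^sub>C f) h = c * cinner f h"
  unfolding cinner_def scaleC.rep_eq mult.assoc
  by (intro infsum_cmult_right cinner_summable)

lemma scaleR_scaleC: "r *\<^sub>R f = complex_of_real r *\<^sub>C f"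
  by (rule ell2_eqI) (simp add: scaleR_ell2.rep_eq scaleC.rep_eq scaleR_conv_of_real)

lemma cinner_commute: "cinner g f = cnj (cinner f g)"
  unfolding cinner_def infsum_cnj[symmetric] by (simp add: mult.commute)

instantiation ell2 :: (type) real_inner
begin
definition "inner_ell2 f g = Re (cinner f g)"
definition "norm_ell2 f = sqrt (\<Sum>\<^sub>\<infinity>x. (cmod (ell2_apply f x))\<^sup>2)"
definition "dist_ell2 f g = norm (f - g :: 'a ell2)"
definition "sgn_ell2 f = f /\<^sub>R norm (f :: 'a ell2)"
definition "uniformity_ell2 = (INF e\<in>{0 <..}. principal {(f, g :: 'a ell2). dist f g < e})"
definition "open_ell2 U = (\<forall>f\<in>U. eventually (\<lambda>(f', g :: 'a ell2). f' = f \<longrightarrow> g \<in> U) uniformity)"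
instance
proof
  fix f g h :: "'a ell2" and r :: real and U :: "'a ell2 set"
  show "dist f g = norm (f - g)" by (rule dist_ell2_def)
  show "sgn f = f /\<^sub>R norm f" by (rule sgn_ell2_def)
  show "uniformity = (INF e\<in>{0 <..}. principal {(f, g :: 'a ell2). dist f g < e})"
    by (rule uniformity_ell2_def)
  show "open U = (\<forall>f\<in>U. eventually (\<lambda>(f', g). f' = f \<longrightarrow> g \<in> U) uniformity)"
    by (rule open_ell2_def)
  show "inner f g = inner g f"
    unfolding inner_ell2_def by (subst cinner_commute) simp
  show "inner (f + g) h = inner f h + inner g h"
    unfolding inner_ell2_def by (simp add: cinner_add_left)
  show "inner (r *\<^sub>R f) g = r * inner f g"
    unfolding inner_ell2_def by (simp add: scaleR_scaleC cinner_scaleC_left)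
  show "0 \<le> inner f f"
    unfolding inner_ell2_def by (simp add: cinner_self infsum_nonneg)
  show "norm f = sqrt (inner f f)"
    unfolding inner_ell2_def norm_ell2_def by (simp add: cinner_self)
  show "inner f f = 0 \<longleftrightarrow> f = 0"
  proof
    assume "inner f f = 0"
    then have *: "(\<Sum>\<^sub>\<infinity>x. (cmod (ell2_apply f x))\<^sup>2) = 0"
      unfolding inner_ell2_def by (simp add: cinner_self)
    have "(cmod (ell2_apply f x))\<^sup>2 = 0" for x
      by (rule nonneg_infsum_le_0D[where A = UNIV, OF _ ell2_summable]) (use * in auto)
    then show "f = 0"
      by (intro ell2_eqI) (simp add: zero_ell2.rep_eq)
  qed (simp add: inner_ell2_def cinner_self zero_ell2.rep_eq)
qed
end

lemma sum_le_norm_sq: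
  "finite F \<Longrightarrow> (\<Sum>x\<in>F. (cmod (ell2_apply f x))\<^sup>2) \<le> (norm f)\<^sup>2"
proof -
  assume "finite F"
  then have "(\<Sum>x\<in>F. (cmod (ell2_apply f x))\<^sup>2) \<le> (\<Sum>\<^sub>\<infinity>x. (cmod (ell2_apply f x))\<^sup>2)"
    by (intro finite_sum_le_infsum ell2_summable) auto
  also have "\<dots> = (norm f)\<^sup>2"
    by (simp add: norm_ell2_def infsum_nonneg)
  finally show ?thesis .
qed

lemma cmod_ell2_le_norm: "cmod (ell2_apply f x) \<le> norm f"
  by (rule power2_le_imp_le) (use sum_le_norm_sq[of "{x}" f] in auto)

lemma ell2_bounded_sums:
  assumes "\<And>F. finite F \<Longrightarrow> (\<Sum>x\<in>F. (cmod (h x))\<^sup>2) \<le> C"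
  shows "(\<lambda>x. (cmod (h x))\<^sup>2) summable_on UNIV" "(\<Sum>\<^sub>\<infinity>x. (cmod (h x))\<^sup>2) \<le> C"
proof -
  show s: "(\<lambda>x. (cmod (h x))\<^sup>2) summable_on UNIV"
    by (rule nonneg_bdd_above_summable_on) (use assms in \<open>auto intro!: bdd_aboveI2\<close>)
  show "(\<Sum>\<^sub>\<infinity>x. (cmod (h x))\<^sup>2) \<le> C"
    by (rule infsum_le_finite_sums[OF s]) (use assms in auto)
qed

instance ell2 :: (type) banach
proof
  fix X :: "nat \<Rightarrow> 'a ell2"
  assume C: "Cauchy X"
  have pt: "convergent (\<lambda>n. ell2_apply (X n) x)" for x
  proof (rule Cauchy_convergent, rule metric_CauchyI)
    fix e :: real assume "0 < e"
    then obtain M where M: "\<And>m n. m \<ge> M \<Longrightarrow> n \<ge> M \<Longrightarrow> dist (X m) (X n) < e"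
      using metric_CauchyD[OF C] by blast
    have "dist (ell2_apply (X m) x) (ell2_apply (X n) x) < e" if "m \<ge> M" "n \<ge> M" for m n
      using cmod_ell2_le_norm[of "X m - X n" x] M[OF that]
      by (simp add: dist_norm minus_ell2.rep_eq)
    then show "\<exists>M. \<forall>m\<ge>M. \<forall>n\<ge>M. dist (ell2_apply (X m) x) (ell2_apply (X n) x) < e"
      by blast
  qed
  define f where "f x = lim (\<lambda>n. ell2_apply (X n) x)" for x
  have f: "(\<lambda>n. ell2_apply (X n) x) \<longlonglongrightarrow> f x" for x
    using pt[of x] by (simp add: f_def convergent_LIMSEQ_iff)
  have key: "(\<Sum>x\<in>F. (cmod (ell2_apply (X m) x - f x))\<^sup>2) \<le> e\<^sup>2"
    if F: "finite F" and m: "m \<ge> M" and M: "\<And>m n. m \<ge> M \<Longrightarrow> n \<ge> M \<Longrightarrow> dist (X m) (X n) < e"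
    for F m M e
  proof (rule LIMSEQ_le_const2)
    show "(\<lambda>n. \<Sum>x\<in>F. (cmod (ell2_apply (X m) x - ell2_apply (X n) x))\<^sup>2)
        \<longlonglongrightarrow> (\<Sum>x\<in>F. (cmod (ell2_apply (X m) x - f x))\<^sup>2)"
      by (intro tendsto_intros f)
    have "(\<Sum>x\<in>F. (cmod (ell2_apply (X m) x - ell2_apply (X n) x))\<^sup>2) \<le> e\<^sup>2" if n: "n \<ge> M" for n
    proof -
      have "(\<Sum>x\<in>F. (cmod (ell2_apply (X m) x - ell2_apply (X n) x))\<^sup>2) \<le> (norm (X m - X n))\<^sup>2"
        using sum_le_norm_sq[OF F, of "X m - X n"] by (simp add: minus_ell2.rep_eq)
      also have "\<dots> \<le> e\<^sup>2"
        using M[OF m n] by (intro power_mono) (auto simp: dist_norm)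
      finally show ?thesis .
    qed
    then show "\<exists>N. \<forall>n\<ge>N. (\<Sum>x\<in>F. (cmod (ell2_apply (X m) x - ell2_apply (X n) x))\<^sup>2) \<le> e\<^sup>2"
      by blast
  qed
  have summ: "(\<lambda>x. (cmod (f x))\<^sup>2) summable_on UNIV"
  proof -
    obtain M where M: "\<And>m n. m \<ge> M \<Longrightarrow> n \<ge> M \<Longrightarrow> dist (X m) (X n) < 1"
      using metric_CauchyD[OF C, of 1] by auto
    have "(\<lambda>x. (cmod (ell2_apply (X M) x - f x))\<^sup>2) summable_on UNIV"
      by (rule ell2_bounded_sums(1)) (rule key[OF _ order_refl M])
    then have "(\<lambda>x. (cmod (f x - ell2_apply (X M) x))\<^sup>2) summable_on UNIV"
      by (simp add: norm_minus_commute)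
    from sq_summable_add[OF this ell2_summable[of "X M"]] show ?thesis
      by simp
  qed
  define L where "L = Abs_ell2 f"
  have L: "ell2_apply L = f"
    unfolding L_def using summ by (simp add: Abs_ell2_inverse)
  have "X \<longlonglongrightarrow> L"
  proof (rule metric_LIMSEQ_I)
    fix r :: real assume r: "0 < r"
    then obtain M where M: "\<And>m n. m \<ge> M \<Longrightarrow> n \<ge> M \<Longrightarrow> dist (X m) (X n) < r / 2"
      using metric_CauchyD[OF C, of "r / 2"] by auto
    have "dist (X m) L < r" if m: "m \<ge> M" for m
    proof -
      have "(\<Sum>\<^sub>\<infinity>x. (cmod (ell2_apply (X m) x - f x))\<^sup>2) \<le> (r / 2)\<^sup>2"
        by (rule ell2_bounded_sums(2)) (rule key[OF _ m M])
      then have "dist (X m) L \<le> r / 2"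
        unfolding dist_norm norm_ell2_def minus_ell2.rep_eq L
        by (intro real_le_lsqrt) (use r in \<open>auto intro: infsum_nonneg\<close>)
      then show ?thesis using r by simp
    qed
    then show "\<exists>M. \<forall>m\<ge>M. dist (X m) L < r" by blast
  qed
  then show "convergent X" by (rule convergentI)
qed

lift_definition delta :: "'a \<Rightarrow> 'a ell2" is "\<lambda>x y. if y = x then 1 else 0"
proof -
  fix x :: 'a
  show "(\<lambda>y. (cmod (if y = x then 1 else 0))\<^sup>2) summable_on UNIV"
    by (rule finite_nonzero_values_imp_summable_on) (rule finite_subset[of _ "{x}"], auto)
qed

lift_definition restrict_ell2 :: "'a set \<Rightarrow> 'a ell2 \<Rightarrow> 'a ell2"
  is "\<lambda>A f x. if x \<in> A then f x else 0"
  by (erule summable_on_comparison_test) auto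

lift_definition chi :: "'a set \<Rightarrow> ('a ell2 \<Rightarrow>\<^sub>L 'a ell2)" is restrict_ell2
proof (rule bounded_linear_intro[where K = 1])
  fix A :: "'a set" and f g :: "'a ell2" and r :: real
  show "restrict_ell2 A (f + g) = restrict_ell2 A f + restrict_ell2 A g"
    by (rule ell2_eqI) (simp add: restrict_ell2.rep_eq plus_ell2.rep_eq)
  show "restrict_ell2 A (r *\<^sub>R f) = r *\<^sub>R restrict_ell2 A f"
    by (rule ell2_eqI) (simp add: restrict_ell2.rep_eq scaleR_ell2.rep_eq)
  have "(\<Sum>\<^sub>\<infinity>x. (cmod (ell2_apply (restrict_ell2 A f) x))\<^sup>2) \<le> (\<Sum>\<^sub>\<infinity>x. (cmod (ell2_apply f x))\<^sup>2)"
    by (intro infsum_mono ell2_summable) (simp add: restrict_ell2.rep_eq)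
  then show "norm (restrict_ell2 A f) \<le> norm f * 1"
    by (simp add: norm_ell2_def)
qed


section \<open>Bounded operators and the quasi-local algebra\<close>

text \<open>The type of bounded linear functions contains all real-linear operators; the complex-linear
  ones are singled out. Their norm is the usual operator norm.\<close>

definition bounded_ops :: "('a ell2 \<Rightarrow>\<^sub>L 'a ell2) set" where
  "bounded_ops = {a. \<forall>c f. blinfun_apply a (c *\<^sub>C f) = c *\<^sub>C blinfun_apply a f}"

definition is_adjoint :: "('a ell2 \<Rightarrow>\<^sub>L 'a ell2) \<Rightarrow> ('a ell2 \<Rightarrow>\<^sub>L 'a ell2) \<Rightarrow> bool" where
  "is_adjoint a b \<longleftrightarrow> (\<forall>f g. cinner (blinfun_apply a f) g = cinner f (blinfun_apply b g))"

definition projection_op :: "('a ell2 \<Rightarrow>\<^sub>L 'a ell2) \<Rightarrow> bool" where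
  "projection_op p \<longleftrightarrow> p \<in> bounded_ops \<and> p o\<^sub>L p = p \<and> is_adjoint p p"

text \<open>Here \<open>0 \<le> z\<close> for complex \<open>z\<close> means that \<open>z\<close> is real and nonnegative.\<close>

definition op_le :: "('a ell2 \<Rightarrow>\<^sub>L 'a ell2) \<Rightarrow> ('a ell2 \<Rightarrow>\<^sub>L 'a ell2) \<Rightarrow> bool" where
  "op_le a b \<longleftrightarrow> (\<forall>f. 0 \<le> cinner (blinfun_apply (b - a) f) f)"

text \<open>The library's \<^const>\<open>setdist\<close> is \<open>0\<close> rather than \<open>\<infinity>\<close> if one of the sets is empty; in that case
  the norm below vanishes anyway.\<close>

definition quasi_local :: "('a::metric_space ell2 \<Rightarrow>\<^sub>L 'a ell2) set" where
  "quasi_local = {a \<in> bounded_ops. \<forall>\<epsilon>>0. \<exists>r>0. \<forall>A B. setdist A B > r \<longrightarrow>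
     norm (chi A o\<^sub>L a o\<^sub>L chi B) \<le> \<epsilon>}"

definition uniformly_locally_finite :: "'a::metric_space itself \<Rightarrow> bool" where
  "uniformly_locally_finite _ \<longleftrightarrow>
     (\<forall>r>0. \<exists>N. \<forall>x::'a. finite (cball x r) \<and> card (cball x r) \<le> N)"


section \<open>The product of matrix algebras\<close>

definition vec_l2norm :: "complex vec \<Rightarrow> real" where
  "vec_l2norm v = L2_set (\<lambda>i. cmod (vec_index v i)) {..<dim_vec v}"

definition mat_opnorm :: "complex mat \<Rightarrow> real" where
  "mat_opnorm A = (SUP v\<in>{v \<in> carrier_vec (dim_col A). vec_l2norm v \<le> 1}. vec_l2norm (A *\<^sub>v v))"

definition mprod :: "(nat \<Rightarrow> nat) \<Rightarrow> (nat \<Rightarrow> complex mat) set" where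
  "mprod n = {a. (\<forall>k. a k \<in> carrier_mat (n k) (n k)) \<and> bdd_above (range (\<lambda>k. mat_opnorm (a k)))}"

definition mprod_norm :: "(nat \<Rightarrow> complex mat) \<Rightarrow> real" where
  "mprod_norm a = (SUP k. mat_opnorm (a k))"

definition mprod_zero :: "(nat \<Rightarrow> nat) \<Rightarrow> nat \<Rightarrow> complex mat" where
  "mprod_zero n = (\<lambda>k. 0\<^sub>m (n k) (n k))"

definition mprod_le :: "(nat \<Rightarrow> nat) \<Rightarrow> (nat \<Rightarrow> complex mat) \<Rightarrow> (nat \<Rightarrow> complex mat) \<Rightarrow> bool" where
  "mprod_le n a b \<longleftrightarrow> (\<forall>k. \<forall>v\<in>carrier_vec (n k). 0 \<le> ((b k - a k) *\<^sub>v v) \<bullet>c v)"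

text \<open>The matrix unit \<open>e\<^sub>i\<^sub>,\<^sub>j\<close> of the \<open>k\<close>-th summand. The indices \<open>i\<close>, \<open>j\<close> start at \<open>1\<close>, whereas
  the entries of a matrix are indexed from \<open>0\<close>.\<close>

definition munit :: "(nat \<Rightarrow> nat) \<Rightarrow> nat \<Rightarrow> nat \<Rightarrow> nat \<Rightarrow> (nat \<Rightarrow> complex mat)" where
  "munit n k i j = (mprod_zero n)
     (k := mat (n k) (n k) (\<lambda>(r, c). if Suc r = i \<and> Suc c = j then 1 else 0))"


section \<open>Normal embeddings\<close>

definition star_hom :: "(nat \<Rightarrow> nat) \<Rightarrow> ((nat \<Rightarrow> complex mat) \<Rightarrow> ('a ell2 \<Rightarrow>\<^sub>L 'a ell2)) \<Rightarrow> bool" where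
  "star_hom n \<Phi> \<longleftrightarrow>
     (\<forall>a\<in>mprod n. \<Phi> a \<in> bounded_ops) \<and>
     (\<forall>a\<in>mprod n. \<forall>b\<in>mprod n. \<Phi> (\<lambda>k. a k + b k) = \<Phi> a + \<Phi> b) \<and>
     (\<forall>a\<in>mprod n. \<forall>c f. blinfun_apply (\<Phi> (\<lambda>k. c \<cdot>\<^sub>m a k)) f = c *\<^sub>C blinfun_apply (\<Phi> a) f) \<and>
     (\<forall>a\<in>mprod n. \<forall>b\<in>mprod n. \<Phi> (\<lambda>k. a k * b k) = \<Phi> a o\<^sub>L \<Phi> b) \<and>
     (\<forall>a\<in>mprod n. is_adjoint (\<Phi> a) (\<Phi> (\<lambda>k. mat_adjoint (a k))))"

definition directed_index :: "'i set \<Rightarrow> ('i \<Rightarrow> 'i \<Rightarrow> bool) \<Rightarrow> bool" where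
  "directed_index I leq \<longleftrightarrow> I \<noteq> {} \<and> (\<forall>i\<in>I. leq i i) \<and>
     (\<forall>i\<in>I. \<forall>j\<in>I. \<forall>k\<in>I. leq i j \<longrightarrow> leq j k \<longrightarrow> leq i k) \<and>
     (\<forall>i\<in>I. \<forall>j\<in>I. \<exists>k\<in>I. leq i k \<and> leq j k)"

definition is_supremum :: "'m set \<Rightarrow> ('m \<Rightarrow> 'm \<Rightarrow> bool) \<Rightarrow> 'm set \<Rightarrow> 'm \<Rightarrow> bool" where
  "is_supremum M leq D s \<longleftrightarrow> s \<in> M \<and> (\<forall>d\<in>D. leq d s) \<and> (\<forall>u\<in>M. (\<forall>d\<in>D. leq d u) \<longrightarrow> leq s u)"

text \<open>Increasing nets are indexed by directed subsets of the type carrying the algebra. This is no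
  restriction: a supremum depends only on the range of a net, and the range of an increasing net is
  an upward directed set, which is itself an increasing net indexed by its own elements.
  An upper bound of a nonempty set of positive elements is itself positive, in particular
  self-adjoint, so the suprema below are those in the ordered space of self-adjoint elements.\<close>

definition normal_map :: "(nat \<Rightarrow> nat) \<Rightarrow> ((nat \<Rightarrow> complex mat) \<Rightarrow> ('a ell2 \<Rightarrow>\<^sub>L 'a ell2)) \<Rightarrow> bool" where
  "normal_map n \<Phi> \<longleftrightarrow>
     (\<forall>(I :: (nat \<Rightarrow> complex mat) set) leq a s.
        directed_index I leq \<and>
        (\<forall>i\<in>I. a i \<in> mprod n \<and> mprod_le n (mprod_zero n) (a i)) \<and>
        (\<forall>i\<in>I. \<forall>j\<in>I. leq i j \<longrightarrow> mprod_le n (a i) (a j)) \<and>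
        (\<exists>C. \<forall>i\<in>I. mprod_norm (a i) \<le> C) \<and>
        is_supremum (mprod n) (mprod_le n) (a ` I) s \<longrightarrow>
        is_supremum bounded_ops op_le ((\<lambda>i. \<Phi> (a i)) ` I) (\<Phi> s))"

definition normal_embedding ::
  "(nat \<Rightarrow> nat) \<Rightarrow> ((nat \<Rightarrow> complex mat) \<Rightarrow> ('a::metric_space ell2 \<Rightarrow>\<^sub>L 'a ell2)) \<Rightarrow> bool" where
  "normal_embedding n \<Phi> \<longleftrightarrow>
     star_hom n \<Phi> \<and> inj_on \<Phi> (mprod n) \<and> \<Phi> ` mprod n \<subseteq> quasi_local \<and> normal_map n \<Phi>"


section \<open>Asymptotic ghosts\<close>

definition orthogonal_projections :: "'s set \<Rightarrow> ('s \<Rightarrow> ('a ell2 \<Rightarrow>\<^sub>L 'a ell2)) \<Rightarrow> bool" where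
  "orthogonal_projections S q \<longleftrightarrow>
     (\<forall>s\<in>S. projection_op (q s)) \<and> (\<forall>s\<in>S. \<forall>t\<in>S. s \<noteq> t \<longrightarrow> q s o\<^sub>L q t = 0)"

text \<open>The sum of an orthogonal family of projections converges in the strong operator topology;
  the vector \<open>v\<close> is the value of this sum at a basis vector.\<close>

definition asymptotically_ghost :: "'s set \<Rightarrow> ('s \<Rightarrow> ('a ell2 \<Rightarrow>\<^sub>L 'a ell2)) \<Rightarrow> bool" where
  "asymptotically_ghost S q \<longleftrightarrow> orthogonal_projections S q \<and>
     (\<forall>\<epsilon>>0. \<exists>F T. finite F \<and> finite T \<and> T \<subseteq> S \<and>
        (\<forall>x. x \<notin> F \<longrightarrow>
           (\<exists>v. ((\<lambda>s. blinfun_apply (q s) (delta x)) has_sum v) (S - T) \<and> norm v < \<epsilon>)))"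

end

(* By a gliding hump argument, normality and quasi-locality of each single operator in the image make
   the images of all block isometries uniformly quasi-local: for every e there is r such that each of
   them maps every delta_x into l2(B_r(x)) up to an error e. Let p be the sum of the units of finitely
   many blocks of size at least m. Pairing matrix coefficients of M_n with point masses shows that one
   can choose, block by block, a cyclic shift, and then signs, such that the resulting signed
   permutation u puts at most the fraction |B_r(x)| / m of the mass of delta_x back into the ball
   B_r(x). As u preserves the norm of p delta_x, and almost all of u p delta_x lives on that ball,
   p delta_x must be small, uniformly in x. *)

theory Submission
  imports Defs
begin

section \<open>Vectors and operators on the Hilbert space\<close>

text \<open>The isometry \<open>u\<close> is built from the point \<open>x\<close>, so the radius
  has to be fixed before either is known; hence the gliding hump is run over the whole family of
  block isometries. Cyclic shifts enter because, inside one block, they partition the matrix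
  positions into permutation patterns: the squared masses that all matrix units put into a ball sum
  to at most its cardinality times the squared mass of the vector on that block, so one of the
  \<open>n k\<close> patterns carries at most a share of 1/\<open>n k\<close>. Once cut down to the
  ball, the images of the units need not be orthogonal; the signs dispose of the cross terms, for
  which no estimate is available. Expanding \<open>\<Phi> u\<close> into matrix units requires
  finite sums, so \<open>u\<close> lives on finitely many blocks. The resulting bound
  \<open>2 * e\<close>, one \<open>e\<close> inside the ball and one outside, does not depend on how
  many there are, and the vanishing of tails, supplied by normality, extends it to all blocks beyond
  \<open>K\<close>.\<close>

lemma cinner_diff_left: "cinner (f - g) h = cinner f h - cinner g h"
  using cinner_add_left[of "f - g" g h] by simp

lemma mult_cnj_eq: "z * cnj z = (complex_of_real (cmod z))\<^sup>2"
  using complex_norm_square[of z] by simp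

lemma cinner_norm: "cinner f f = of_real ((norm f)\<^sup>2)"
  unfolding cinner_self norm_ell2_def by (simp add: infsum_nonneg)

lemma norm_scaleC: "norm (c *\<^sub>C f) = cmod c * norm f"
proof -
  have "cinner (c *\<^sub>C f) (c *\<^sub>C f) = c * cnj (c * cinner f f)"
    by (subst cinner_scaleC_left, subst cinner_commute, subst cinner_scaleC_left) (rule refl)
  also have "\<dots> = (c * cnj c) * cinner f f"
    by (simp add: cinner_norm)
  finally have "cinner (c *\<^sub>C f) (c *\<^sub>C f) = (c * cnj c) * cinner f f" .
  then have "complex_of_real ((norm (c *\<^sub>C f))\<^sup>2) = complex_of_real ((cmod c * norm f)\<^sup>2)"
    unfolding cinner_norm by (simp add: mult_cnj_eq power_mult_distrib)
  then have "(norm (c *\<^sub>C f))\<^sup>2 = (cmod c * norm f)\<^sup>2"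
    by (simp only: of_real_eq_iff)
  then show ?thesis
    by (simp add: power2_eq_iff_nonneg)
qed

lemma cmod_cinner_le: "cmod (cinner f g) \<le> norm f * norm g"
proof (cases "cinner f g = 0")
  case False
  \<comment> \<open>A unimodular factor that rotates the inner product onto its modulus and so
    reduces the claim to the real Cauchy-Schwarz inequality.\<close>
  define c where "c = cnj (cinner f g) / cmod (cinner f g)"
  have c: "cmod c = 1"
    using False by (simp add: c_def norm_divide)
  have "cinner (c *\<^sub>C f) g = of_real (cmod (cinner f g))"
    using False mult_cnj_eq[of "cinner f g"] unfolding cinner_scaleC_left c_def
    by (simp add: power2_eq_square field_simps)
  then have "cmod (cinner f g) = inner (c *\<^sub>C f) g"
    by (simp add: inner_ell2_def)
  also have "\<dots> \<le> norm (c *\<^sub>C f) * norm g"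
    by (rule norm_cauchy_schwarz)
  finally show ?thesis
    by (simp add: norm_scaleC c)
qed simp

lemma cinner_delta: "cinner f (delta x) = ell2_apply f x"
proof -
  have "cinner f (delta x) = (\<Sum>\<^sub>\<infinity>y. if y = x then ell2_apply f x else 0)"
    unfolding cinner_def delta.rep_eq by (intro infsum_cong) auto
  also have "\<dots> = (\<Sum>\<^sub>\<infinity>y\<in>{x}. ell2_apply f x)"
    by (intro infsum_cong_neutral) auto
  finally show ?thesis by simp
qed

lemma norm_delta: "norm (delta x) = 1"
proof -
  have "cinner (delta x) (delta x) = 1"
    by (simp add: cinner_delta delta.rep_eq)
  then have "(norm (delta x))\<^sup>2 = 1\<^sup>2"
    unfolding cinner_norm of_real_eq_1_iff by simp
  then show ?thesis
    by (simp only: power2_eq_iff_nonneg norm_ge_zero zero_le_one)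
qed

lemma norm_chi_le: "norm (blinfun_apply (chi A) f) \<le> norm f"
  unfolding chi.rep_eq norm_ell2_def
  by (intro real_sqrt_le_mono infsum_mono ell2_summable) (simp add: restrict_ell2.rep_eq)

lemma chi_Compl: "blinfun_apply (chi A) f + blinfun_apply (chi (- A)) f = f"
  by (rule ell2_eqI) (simp add: chi.rep_eq restrict_ell2.rep_eq plus_ell2.rep_eq)

lemma chi_scaleC: "blinfun_apply (chi A) (c *\<^sub>C f) = c *\<^sub>C blinfun_apply (chi A) f"
  by (rule ell2_eqI) (simp add: chi.rep_eq restrict_ell2.rep_eq scaleC.rep_eq)

lemma chi_delta: "x \<in> A \<Longrightarrow> blinfun_apply (chi A) (delta x) = delta x"
  by (rule ell2_eqI) (simp add: chi.rep_eq restrict_ell2.rep_eq delta.rep_eq)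

lemma chi_empty: "chi {} = 0"
  by (rule blinfun_eqI, rule ell2_eqI) (simp add: chi.rep_eq restrict_ell2.rep_eq zero_ell2.rep_eq)

lemma norm_chi_finite:
  assumes "finite B"
  shows "(norm (blinfun_apply (chi B) f))\<^sup>2 = (\<Sum>y\<in>B. (cmod (ell2_apply f y))\<^sup>2)"
proof -
  have "(norm (blinfun_apply (chi B) f))\<^sup>2 = (\<Sum>\<^sub>\<infinity>y. (cmod (ell2_apply (blinfun_apply (chi B) f) y))\<^sup>2)"
    by (simp add: norm_ell2_def infsum_nonneg)
  also have "\<dots> = (\<Sum>\<^sub>\<infinity>y\<in>B. (cmod (ell2_apply f y))\<^sup>2)"
    by (intro infsum_cong_neutral) (auto simp: chi.rep_eq restrict_ell2.rep_eq)
  finally show ?thesis using assms by simp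
qed

lemma scaleC_of_real: "of_real r *\<^sub>C f = r *\<^sub>R f"
  by (simp add: scaleR_scaleC)

text \<open>The signs are chosen greedily: each new one makes the cross term with the partial sum
  nonpositive. This stands in for orthogonality of the vectors.\<close>

lemma exists_signs_norm_sum_le:
  fixes w :: "'t \<Rightarrow> 'v::real_inner"
  assumes "finite W"
  shows "\<exists>s. (\<forall>t. s t = 1 \<or> s t = - 1) \<and>
    (norm (\<Sum>t\<in>W. s t *\<^sub>R w t))\<^sup>2 \<le> (\<Sum>t\<in>W. (norm (w t))\<^sup>2)"
  using assms
proof (induction W)
  case empty
  show ?case by (auto intro: exI[of _ "\<lambda>_. 1"])
next
  case (insert t W)
  then obtain s where s: "\<And>t. s t = 1 \<or> s t = - 1"
    "(norm (\<Sum>t\<in>W. s t *\<^sub>R w t))\<^sup>2 \<le> (\<Sum>t\<in>W. (norm (w t))\<^sup>2)"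
    by blast
  define v where "v = (\<Sum>t\<in>W. s t *\<^sub>R w t)"
  define c :: real where "c = (if inner (w t) v \<le> 0 then 1 else - 1)"
  have "(\<Sum>r\<in>insert t W. (s(t := c)) r *\<^sub>R w r) = c *\<^sub>R w t + v"
    using insert.hyps by (auto simp: v_def intro!: sum.cong)
  moreover have "(norm (c *\<^sub>R w t + v))\<^sup>2 \<le> (norm (w t))\<^sup>2 + (norm v)\<^sup>2"
  proof -
    have "(norm (c *\<^sub>R w t + v))\<^sup>2 = c\<^sup>2 * (norm (w t))\<^sup>2 + 2 * (c * inner (w t) v) + (norm v)\<^sup>2"
      unfolding power2_norm_eq_inner
      by (simp add: inner_add_left inner_add_right inner_commute[of v "w t"] power2_eq_square
          algebra_simps)
    moreover have "c\<^sup>2 = 1" "c * inner (w t) v \<le> 0"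
      by (auto simp: c_def)
    ultimately show ?thesis by simp
  qed
  ultimately have le: "(norm (\<Sum>r\<in>insert t W. (s(t := c)) r *\<^sub>R w r))\<^sup>2 \<le> (norm (w t))\<^sup>2 + (norm v)\<^sup>2"
    by (simp only:)
  show ?case
  proof (intro exI[of _ "s(t := c)"] conjI allI)
    show "(s(t := c)) r = 1 \<or> (s(t := c)) r = - 1" for r
      using s(1) by (simp add: c_def)
    have "(norm (\<Sum>r\<in>insert t W. (s(t := c)) r *\<^sub>R w r))\<^sup>2 \<le> (norm (w t))\<^sup>2 + (norm v)\<^sup>2"
      by (rule le)
    also have "\<dots> \<le> (norm (w t))\<^sup>2 + (\<Sum>t\<in>W. (norm (w t))\<^sup>2)"
      using s(2) by (simp add: v_def)
    also have "\<dots> = (\<Sum>t\<in>insert t W. (norm (w t))\<^sup>2)"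
      using insert.hyps by simp
    finally show "(norm (\<Sum>r\<in>insert t W. (s(t := c)) r *\<^sub>R w r))\<^sup>2 \<le> (\<Sum>t\<in>insert t W. (norm (w t))\<^sup>2)" .
  qed
qed

section \<open>Blocks of the matrix product\<close>

lemma dim_mat_adjoint: "A \<in> carrier_mat m m \<Longrightarrow> mat_adjoint A \<in> carrier_mat m m"
  by (intro carrier_matI) (simp_all add: mat_adjoint_def)

lemma index_mat_adjoint:
  "A \<in> carrier_mat m m \<Longrightarrow> i < m \<Longrightarrow> j < m \<Longrightarrow> mat_adjoint A $$ (i, j) = cnj (A $$ (j, i))"
  by (auto simp: mat_adjoint_def mat_of_rows_def)

lemma index_mult_sum:
  assumes "A \<in> carrier_mat m m" "B \<in> carrier_mat m m" "i < m" "j < m"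
  shows "(A * B) $$ (i, j) = (\<Sum>l<m. A $$ (i, l) * B $$ (l, j))"
  using assms by (auto simp: scalar_prod_def atLeast0LessThan)

lemma vec_l2norm_cscalar: "of_real ((vec_l2norm v)\<^sup>2) = v \<bullet>c v"
  by (simp add: vec_l2norm_def L2_set_def sum_nonneg scalar_prod_def atLeast0LessThan
      mult_cnj_eq)

lemma vec_l2norm_nonneg: "0 \<le> vec_l2norm v"
  by (simp add: vec_l2norm_def)

lemma cscalar_mult_adjoint:
  fixes A :: "complex mat"
  assumes A: "A \<in> carrier_mat m m" and v: "v \<in> carrier_vec m" and w: "w \<in> carrier_vec m"
  shows "(A *\<^sub>v v) \<bullet>c w = v \<bullet>c (mat_adjoint A *\<^sub>v w)"
proof -
  have "(A *\<^sub>v v) \<bullet>c w = (\<Sum>i<m. \<Sum>j<m. A $$ (i, j) * vec_index v j * cnj (vec_index w i))"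
    using assms by (auto simp: scalar_prod_def atLeast0LessThan sum_distrib_right intro!: sum.cong)
  also have "\<dots> = (\<Sum>j<m. \<Sum>i<m. A $$ (i, j) * vec_index v j * cnj (vec_index w i))"
    by (rule sum.swap)
  also have "\<dots> = v \<bullet>c (mat_adjoint A *\<^sub>v w)"
    using assms dim_mat_adjoint[OF A]
    by (auto simp: scalar_prod_def atLeast0LessThan sum_distrib_left index_mat_adjoint[OF A]
        mult_ac intro!: sum.cong)
  finally show ?thesis .
qed

lemma cmod_cscalar_le: "dim_vec v = dim_vec w \<Longrightarrow> cmod (v \<bullet>c w) \<le> vec_l2norm v * vec_l2norm w"
proof -
  assume d: "dim_vec v = dim_vec w"
  have "cmod (v \<bullet>c w) \<le> (\<Sum>i<dim_vec w. \<bar>cmod (vec_index v i)\<bar> * \<bar>cmod (vec_index w i)\<bar>)"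
    by (auto simp: scalar_prod_def atLeast0LessThan norm_mult intro: sum_norm_le)
  also have "\<dots> \<le> vec_l2norm v * vec_l2norm w"
    unfolding vec_l2norm_def d by (rule L2_set_mult_ineq)
  finally show ?thesis .
qed

text \<open>The squared norm of \<open>A* w\<close> is the inner product of \<open>A A* w\<close>
  with \<open>w\<close>, hence at most the product of the norms of \<open>A* w\<close> and
  \<open>w\<close>. It puts adjoints of block isometries into \<open>mprod n\<close>, so that
  \<open>\<Phi>\<close> is multiplicative on \<open>u* u\<close>.\<close>

lemma adjoint_contractive:
  fixes A :: "complex mat"
  assumes A: "A \<in> carrier_mat m m"
    and le: "\<And>v. v \<in> carrier_vec m \<Longrightarrow> vec_l2norm (A *\<^sub>v v) \<le> vec_l2norm v"
    and w: "w \<in> carrier_vec m"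
  shows "vec_l2norm (mat_adjoint A *\<^sub>v w) \<le> vec_l2norm w"
proof -
  define z where "z = mat_adjoint A *\<^sub>v w"
  have z: "z \<in> carrier_vec m"
    unfolding z_def using dim_mat_adjoint[OF A] w by auto
  have Az: "A *\<^sub>v z \<in> carrier_vec m"
    using A z by auto
  have "complex_of_real ((vec_l2norm z)\<^sup>2) = (A *\<^sub>v z) \<bullet>c w"
    unfolding vec_l2norm_cscalar cscalar_mult_adjoint[OF A z w] by (simp add: z_def)
  then have "(vec_l2norm z)\<^sup>2 = cmod ((A *\<^sub>v z) \<bullet>c w)"
    by (metis abs_of_nonneg norm_of_real zero_le_power2)
  also have "\<dots> \<le> vec_l2norm (A *\<^sub>v z) * vec_l2norm w"
    by (rule cmod_cscalar_le) (simp only: carrier_vecD[OF Az] carrier_vecD[OF w])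
  also have "\<dots> \<le> vec_l2norm z * vec_l2norm w"
    by (intro mult_right_mono le z vec_l2norm_nonneg)
  finally have "vec_l2norm z * vec_l2norm z \<le> vec_l2norm z * vec_l2norm w"
    by (simp add: power2_eq_square)
  then show ?thesis
    using vec_l2norm_nonneg[of z] vec_l2norm_nonneg[of w] unfolding z_def[symmetric]
    by (cases "vec_l2norm z = 0") (auto simp: mult_le_cancel_left)
qed

lemma mat_opnorm_le:
  assumes "\<And>v. v \<in> carrier_vec (dim_col A) \<Longrightarrow> vec_l2norm (A *\<^sub>v v) \<le> C * vec_l2norm v" "0 \<le> C"
  shows "mat_opnorm A \<le> C"
  unfolding mat_opnorm_def
proof (rule cSUP_least)
  have "vec_l2norm (0\<^sub>v (dim_col A)) = 0"
    by (simp add: vec_l2norm_def L2_set_def)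
  then show "{v \<in> carrier_vec (dim_col A). vec_l2norm v \<le> 1} \<noteq> {}"
    by (auto intro!: exI[of _ "0\<^sub>v (dim_col A)"])
  fix v assume "v \<in> {v \<in> carrier_vec (dim_col A). vec_l2norm v \<le> 1}"
  then show "vec_l2norm (A *\<^sub>v v) \<le> C"
    using assms(1)[of v] mult_left_mono[of "vec_l2norm v" 1 C] \<open>0 \<le> C\<close> by auto
qed

lemma mat_opnorm_zero: "mat_opnorm (0\<^sub>m m m) \<le> 0"
  by (rule mat_opnorm_le) (auto simp: vec_l2norm_def L2_set_def scalar_prod_def)

lemma mprod_finite_support:
  assumes "\<And>k. a k \<in> carrier_mat (n k) (n k)" "finite J" "\<And>k. k \<notin> J \<Longrightarrow> a k = 0\<^sub>m (n k) (n k)"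
  shows "a \<in> mprod n"
proof -
  have "bdd_above ((\<lambda>k. mat_opnorm (a k)) ` J \<union> {..0})"
    using assms(2) by simp
  moreover have "range (\<lambda>k. mat_opnorm (a k)) \<subseteq> (\<lambda>k. mat_opnorm (a k)) ` J \<union> {..0}"
    using assms(3) mat_opnorm_zero by fastforce
  ultimately have "bdd_above (range (\<lambda>k. mat_opnorm (a k)))"
    by (rule bdd_above_mono)
  then show ?thesis
    unfolding mprod_def using assms(1) by simp
qed

text \<open>As in \<^const>\<open>munit\<close>, the first component of a pair in \<open>W\<close> is a row index starting at \<open>1\<close>.\<close>

definition dproj :: "(nat \<Rightarrow> nat) \<Rightarrow> (nat \<times> nat) set \<Rightarrow> nat \<Rightarrow> complex mat" where
  "dproj n W = (\<lambda>k. mat (n k) (n k) (\<lambda>(i, j). if i = j \<and> (Suc i, k) \<in> W then 1 else 0))"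

text \<open>Row indices are left unbounded: \<open>dproj\<close> reads only rows 1 to
  \<open>n k\<close> of block \<open>k\<close>, so the surplus pairs have no effect, and set
  operations on blocks stay simple.\<close>

definition blocks :: "nat set \<Rightarrow> (nat \<times> nat) set" where
  "blocks A = UNIV \<times> A"

text \<open>The matrices are square, so \<open>u k\<close> is unitary for \<open>k\<close> in
  \<open>A\<close>, and it is 0 for the other \<open>k\<close>.\<close>

definition block_isometry :: "(nat \<Rightarrow> nat) \<Rightarrow> nat set \<Rightarrow> (nat \<Rightarrow> complex mat) \<Rightarrow> bool" where
  "block_isometry n A u \<longleftrightarrow> (\<forall>k. u k \<in> carrier_mat (n k) (n k) \<and>
     mat_adjoint (u k) * u k = dproj n (blocks A) k)"

lemma dproj_carrier: "dproj n W k \<in> carrier_mat (n k) (n k)"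
  by (simp add: dproj_def)

lemma dproj_mult: "dproj n W k * dproj n V k = dproj n (W \<inter> V) k"
proof (rule eq_matI; (simp add: dproj_def; fail)?)
  fix i j assume "i < dim_row (dproj n (W \<inter> V) k)" "j < dim_col (dproj n (W \<inter> V) k)"
  then have ij: "i < n k" "j < n k" by (auto simp: dproj_def)
  have "(dproj n W k * dproj n V k) $$ (i, j) =
      (\<Sum>l<n k. if l = j then (if i = j \<and> (Suc i, k) \<in> W \<inter> V then 1 else 0) else 0)"
    unfolding index_mult_sum[OF dproj_carrier[of n W k] dproj_carrier[of n V k] ij]
    using ij by (intro sum.cong) (auto simp: dproj_def)
  also have "\<dots> = dproj n (W \<inter> V) k $$ (i, j)"
    using ij by (simp add: dproj_def)
  finally show "(dproj n W k * dproj n V k) $$ (i, j) = dproj n (W \<inter> V) k $$ (i, j)" .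
qed

lemma dproj_adjoint: "mat_adjoint (dproj n W k) = dproj n W k"
proof (rule eq_matI)
  fix i j assume "i < dim_row (dproj n W k)" "j < dim_col (dproj n W k)"
  then have ij: "i < n k" "j < n k" by (auto simp: dproj_def)
  then show "mat_adjoint (dproj n W k) $$ (i, j) = dproj n W k $$ (i, j)"
    unfolding index_mat_adjoint[OF dproj_carrier[of n W k] ij] by (auto simp: dproj_def)
qed (use dim_mat_adjoint[OF dproj_carrier[of n W k]] in \<open>auto simp: dproj_def\<close>)

lemma dproj_Un: "W \<inter> V = {} \<Longrightarrow> dproj n W k + dproj n V k = dproj n (W \<union> V) k"
  by (rule eq_matI) (auto simp: dproj_def)

lemma munit_dproj: "munit n k (Suc i) (Suc i) = dproj n {(Suc i, k)}"
  by (rule ext) (auto simp: munit_def mprod_zero_def dproj_def intro!: eq_matI)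

lemma block_isometry_dproj: "block_isometry n A (dproj n (blocks A))"
  by (simp add: block_isometry_def dproj_carrier dproj_adjoint dproj_mult)

lemma block_isometry_contractive:
  assumes "block_isometry n A u" and v: "v \<in> carrier_vec (n k)"
  shows "vec_l2norm (u k *\<^sub>v v) \<le> vec_l2norm v"
proof -
  have u: "u k \<in> carrier_mat (n k) (n k)" and iso: "mat_adjoint (u k) * u k = dproj n (blocks A) k"
    using assms by (auto simp: block_isometry_def)
  have d: "dproj n (blocks A) k = (if k \<in> A then 1\<^sub>m (n k) else 0\<^sub>m (n k) (n k))"
    by (rule eq_matI) (auto simp: dproj_def blocks_def)
  have "complex_of_real ((vec_l2norm (u k *\<^sub>v v))\<^sup>2) = v \<bullet>c (mat_adjoint (u k) *\<^sub>v (u k *\<^sub>v v))"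
    unfolding vec_l2norm_cscalar using u v by (intro cscalar_mult_adjoint) auto
  also have "mat_adjoint (u k) *\<^sub>v (u k *\<^sub>v v) = dproj n (blocks A) k *\<^sub>v v"
    unfolding iso[symmetric] by (rule assoc_mult_mat_vec[OF dim_mat_adjoint[OF u] u v, symmetric])
  also have "v \<bullet>c (dproj n (blocks A) k *\<^sub>v v) = of_real (if k \<in> A then (vec_l2norm v)\<^sup>2 else 0)"
  proof -
    have "0\<^sub>m (n k) (n k) *\<^sub>v v = 0\<^sub>v (n k)" using v by auto
    then show ?thesis using v by (auto simp: d vec_l2norm_cscalar[symmetric])
  qed
  finally have "(vec_l2norm (u k *\<^sub>v v))\<^sup>2 = (if k \<in> A then (vec_l2norm v)\<^sup>2 else 0)"
    by (simp only: of_real_eq_iff)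
  then have "(vec_l2norm (u k *\<^sub>v v))\<^sup>2 \<le> (vec_l2norm v)\<^sup>2"
    by auto
  then show ?thesis
    by (rule power2_le_imp_le) (rule vec_l2norm_nonneg)
qed

lemma block_isometry_carrier: "block_isometry n A u \<Longrightarrow> u k \<in> carrier_mat (n k) (n k)"
  unfolding block_isometry_def by blast

lemma block_isometry_opnorm:
  assumes "block_isometry n A u"
  shows "mat_opnorm (u k) \<le> 1"
proof (rule mat_opnorm_le)
  fix v :: "complex vec" assume "v \<in> carrier_vec (dim_col (u k))"
  then show "vec_l2norm (u k *\<^sub>v v) \<le> 1 * vec_l2norm v"
    using block_isometry_contractive[OF assms, of v k] block_isometry_carrier[OF assms, of k] by simp
qed simp

lemma block_isometry_mprod:
  assumes "block_isometry n A u"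
  shows "u \<in> mprod n"
proof -
  have "bdd_above (range (\<lambda>k. mat_opnorm (u k)))"
    by (rule bdd_aboveI2[where M = 1]) (rule block_isometry_opnorm[OF assms])
  then show ?thesis
    using block_isometry_carrier[OF assms] by (simp add: mprod_def)
qed

lemma block_isometry_adjoint_mprod:
  assumes "block_isometry n A u"
  shows "(\<lambda>k. mat_adjoint (u k)) \<in> mprod n"
proof -
  have u: "u k \<in> carrier_mat (n k) (n k)" for k
    using assms by (rule block_isometry_carrier)
  have "mat_opnorm (mat_adjoint (u k)) \<le> 1" for k
  proof (rule mat_opnorm_le)
    fix v :: "complex vec" assume "v \<in> carrier_vec (dim_col (mat_adjoint (u k)))"
    then have v: "v \<in> carrier_vec (n k)"
      using dim_mat_adjoint[OF u[of k]] by simp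
    show "vec_l2norm (mat_adjoint (u k) *\<^sub>v v) \<le> 1 * vec_l2norm v"
      using adjoint_contractive[OF u block_isometry_contractive[OF assms] v] by simp
  qed simp
  then have "bdd_above (range (\<lambda>k. mat_opnorm (mat_adjoint (u k))))"
    by (rule bdd_aboveI2)
  then show ?thesis
    using dim_mat_adjoint[OF u] by (simp add: mprod_def)
qed

lemma dproj_mprod: "dproj n W \<in> mprod n"
proof -
  have "mat_opnorm (dproj n W k) \<le> 1" for k
  proof (rule mat_opnorm_le)
    fix v :: "complex vec" assume "v \<in> carrier_vec (dim_col (dproj n W k))"
    then have v: "v \<in> carrier_vec (n k)" by (auto simp: dproj_def)
    have "vec_index (dproj n W k *\<^sub>v v) i = (if (Suc i, k) \<in> W then vec_index v i else 0)" if "i < n k" for i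
    proof -
      have "vec_index (dproj n W k *\<^sub>v v) i = (\<Sum>j<n k. dproj n W k $$ (i, j) * vec_index v j)"
        using that v by (simp add: dproj_def scalar_prod_def atLeast0LessThan)
      also have "\<dots> = (\<Sum>j<n k. if j = i then (if (Suc i, k) \<in> W then vec_index v i else 0) else 0)"
        using that by (intro sum.cong) (auto simp: dproj_def)
      finally show ?thesis using that by simp
    qed
    then have "vec_l2norm (dproj n W k *\<^sub>v v) \<le> vec_l2norm v"
      using v dproj_carrier[of n W k] unfolding vec_l2norm_def
      by (auto intro!: L2_set_mono)
    then show "vec_l2norm (dproj n W k *\<^sub>v v) \<le> 1 * vec_l2norm v" by simp
  qed simp
  then have "bdd_above (range (\<lambda>k. mat_opnorm (dproj n W k)))"
    by (rule bdd_aboveI2)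
  then show ?thesis
    by (simp add: mprod_def dproj_carrier)
qed

text \<open>A diagonal entry of \<open>u* u\<close> is the squared norm of a column of
  \<open>u\<close>, and it equals 0 or 1.\<close>

lemma block_isometry_entry_le:
  assumes "block_isometry n A u" "i < n k" "j < n k"
  shows "cmod (u k $$ (i, j)) \<le> 1"
proof -
  have u: "u k \<in> carrier_mat (n k) (n k)" and iso: "mat_adjoint (u k) * u k = dproj n (blocks A) k"
    using assms by (auto simp: block_isometry_def)
  have "dproj n (blocks A) k $$ (j, j) = (\<Sum>l<n k. mat_adjoint (u k) $$ (j, l) * u k $$ (l, j))"
    unfolding iso[symmetric] by (rule index_mult_sum[OF dim_mat_adjoint[OF u] u assms(3,3)])
  also have "\<dots> = (\<Sum>l<n k. (complex_of_real (cmod (u k $$ (l, j))))\<^sup>2)"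
  proof (rule sum.cong)
    fix l assume "l \<in> {..<n k}"
    then show "mat_adjoint (u k) $$ (j, l) * u k $$ (l, j) = (complex_of_real (cmod (u k $$ (l, j))))\<^sup>2"
      using assms(3) by (simp add: index_mat_adjoint[OF u] mult_cnj_eq[symmetric] mult.commute)
  qed simp
  finally have "complex_of_real (\<Sum>l<n k. (cmod (u k $$ (l, j)))\<^sup>2) = dproj n (blocks A) k $$ (j, j)"
    by simp
  also have "\<dots> = complex_of_real (if k \<in> A then 1 else 0)"
    using assms by (simp add: dproj_def blocks_def)
  finally have "(\<Sum>l<n k. (cmod (u k $$ (l, j)))\<^sup>2) \<le> 1"
    unfolding of_real_eq_iff by auto
  moreover have "(cmod (u k $$ (i, j)))\<^sup>2 \<le> (\<Sum>l<n k. (cmod (u k $$ (l, j)))\<^sup>2)"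
    using assms by (intro member_le_sum) auto
  ultimately have "(cmod (u k $$ (i, j)))\<^sup>2 \<le> 1\<^sup>2" by simp
  then show ?thesis
    by (rule power2_le_imp_le) simp
qed

text \<open>The difference is again a diagonal projection \<open>D\<close>, and the inner product of
  \<open>D v\<close> with \<open>v\<close> is the squared norm of \<open>D v\<close>.\<close>

lemma dproj_le:
  assumes "W \<subseteq> V"
  shows "mprod_le n (dproj n W) (dproj n V)"
  unfolding mprod_le_def
proof (intro allI ballI)
  fix k and v :: "complex vec" assume v: "v \<in> carrier_vec (n k)"
  define D where "D = dproj n (V - W) k"
  have D: "D \<in> carrier_mat (n k) (n k)" "mat_adjoint D = D" "D * D = D"
    by (simp_all add: D_def dproj_carrier dproj_adjoint dproj_mult)
  have Dv: "D *\<^sub>v v \<in> carrier_vec (n k)"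
    using D(1) v by (rule mult_mat_vec_carrier)
  have "dproj n V k - dproj n W k = D"
    using assms by (intro eq_matI) (auto simp: D_def dproj_def)
  moreover have "(D *\<^sub>v v) \<bullet>c v = of_real ((vec_l2norm (D *\<^sub>v v))\<^sup>2)"
  proof -
    have "(D *\<^sub>v (D *\<^sub>v v)) \<bullet>c v = (D *\<^sub>v v) \<bullet>c (D *\<^sub>v v)"
      using cscalar_mult_adjoint[OF D(1) Dv v] D(2) by simp
    moreover have "D *\<^sub>v (D *\<^sub>v v) = D *\<^sub>v v"
      using assoc_mult_mat_vec[OF D(1) D(1) v] D(3) by simp
    ultimately show ?thesis
      by (simp only: vec_l2norm_cscalar)
  qed
  ultimately show "0 \<le> ((dproj n V k - dproj n W k) *\<^sub>v v) \<bullet>c v"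
    by (simp add: less_eq_complex_def)
qed

text \<open>The order is blockwise, and block \<open>k\<close> already has its final value at
  \<open>K = Suc k\<close>.\<close>

lemma dproj_UNIV_supremum:
  "is_supremum (mprod n) (mprod_le n) (range (\<lambda>K. dproj n (blocks {..<K}))) (dproj n UNIV)"
  unfolding is_supremum_def
proof (intro conjI ballI impI)
  fix u assume u: "\<forall>d\<in>range (\<lambda>K. dproj n (blocks {..<K})). mprod_le n d u"
  have "dproj n (blocks {..<Suc k}) k = dproj n UNIV k" for k
    by (simp add: dproj_def blocks_def)
  then show "mprod_le n (dproj n UNIV) u"
    using u unfolding mprod_le_def by (metis rangeI)
qed (auto simp: dproj_mprod intro: dproj_le)

lemma blocks_simps:
  "blocks {} = {}" "blocks UNIV = UNIV"
  by (auto simp: blocks_def)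


section \<open>Finite combinations of matrix units and signed cyclic shifts\<close>

text \<open>A triple lists block, row and column, with rows and columns counted from 0; the pairs
  used by \<open>dproj\<close> put the row first and count it from 1.\<close>

definition mcomb ::
  "(nat \<Rightarrow> nat) \<Rightarrow> (nat \<times> nat \<times> nat) set \<Rightarrow> (nat \<Rightarrow> nat \<Rightarrow> nat \<Rightarrow> complex) \<Rightarrow> nat \<Rightarrow> complex mat" where
  "mcomb n W g = (\<lambda>k. mat (n k) (n k) (\<lambda>(i, j). if (k, i, j) \<in> W then g k i j else 0))"

definition diag_index :: "(nat \<Rightarrow> nat) \<Rightarrow> (nat \<times> nat) set" where
  "diag_index n = {(i, k). 1 \<le> i \<and> i \<le> n k}"

lemma dproj_diag_index: "dproj n (W \<inter> diag_index n) = dproj n W"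
  unfolding dproj_def by (intro ext eq_matI) (auto simp: diag_index_def)

lemma dproj_blocks: "dproj n (blocks A) k = (if k \<in> A then 1\<^sub>m (n k) else 0\<^sub>m (n k) (n k))"
  by (rule eq_matI) (auto simp: dproj_def blocks_def)

lemma mcomb_mprod: "finite W \<Longrightarrow> mcomb n W g \<in> mprod n"
  by (rule mprod_finite_support[of _ _ "fst ` W"])
    (force simp: mcomb_def intro!: eq_matI)+

lemma munit_index:
  "munit n k (Suc i) (Suc j) k' =
    mat (n k') (n k') (\<lambda>(r, c). if k' = k \<and> r = i \<and> c = j then 1 else 0)"
  by (rule eq_matI) (auto simp: munit_def mprod_zero_def)

lemma munit_carrier: "munit n k (Suc i) (Suc j) k' \<in> carrier_mat (n k') (n k')"
  unfolding munit_index by simp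

lemma munit_mprod: "munit n k (Suc i) (Suc j) \<in> mprod n"
  by (rule mprod_finite_support[of _ _ "{k}"])
    (auto simp: munit_index intro!: eq_matI)

lemma munit_adjoint: "mat_adjoint (munit n k (Suc i) (Suc j) k') = munit n k (Suc j) (Suc i) k'"
proof (rule eq_matI)
  fix r c assume "r < dim_row (munit n k (Suc j) (Suc i) k')" "c < dim_col (munit n k (Suc j) (Suc i) k')"
  then have rc: "r < n k'" "c < n k'" by (auto simp: munit_index)
  then show "mat_adjoint (munit n k (Suc i) (Suc j) k') $$ (r, c) = munit n k (Suc j) (Suc i) k' $$ (r, c)"
    unfolding index_mat_adjoint[OF munit_carrier[of n k i j k'] rc] by (auto simp: munit_index)
qed (use dim_mat_adjoint[OF munit_carrier[of n k i j k']] in \<open>auto simp: munit_index\<close>)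

lemma munit_mult:
  assumes "j < n k"
  shows "munit n k (Suc i) (Suc j) k' * munit n k (Suc j) (Suc l) k' = munit n k (Suc i) (Suc l) k'"
proof (rule eq_matI)
  fix r c assume "r < dim_row (munit n k (Suc i) (Suc l) k')" "c < dim_col (munit n k (Suc i) (Suc l) k')"
  then have rc: "r < n k'" "c < n k'" by (auto simp: munit_index)
  have "(munit n k (Suc i) (Suc j) k' * munit n k (Suc j) (Suc l) k') $$ (r, c) =
      (\<Sum>m<n k'. if m = j then (if k' = k \<and> r = i \<and> c = l then 1 else 0) else 0)"
    unfolding index_mult_sum[OF munit_carrier[of n k i j k'] munit_carrier[of n k j l k'] rc]
    using rc by (intro sum.cong) (auto simp: munit_index)
  also have "\<dots> = munit n k (Suc i) (Suc l) k' $$ (r, c)"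
    using rc assms by (auto simp: munit_index)
  finally show "(munit n k (Suc i) (Suc j) k' * munit n k (Suc j) (Suc l) k') $$ (r, c) =
    munit n k (Suc i) (Suc l) k' $$ (r, c)" .
qed (auto simp: munit_index)

lemma mcomb_insert:
  assumes "(k, i, j) \<notin> W"
  shows "mcomb n (insert (k, i, j) W) g =
    (\<lambda>k'. mcomb n W g k' + g k i j \<cdot>\<^sub>m munit n k (Suc i) (Suc j) k')"
proof
  fix k'
  show "mcomb n (insert (k, i, j) W) g k' = mcomb n W g k' + g k i j \<cdot>\<^sub>m munit n k (Suc i) (Suc j) k'"
    using assms by (intro eq_matI) (auto simp: mcomb_def munit_index)
qed

lemma smult_munit_mprod: "(\<lambda>k'. c \<cdot>\<^sub>m munit n k (Suc i) (Suc j) k') \<in> mprod n"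
  by (rule mprod_finite_support[of _ _ "{k}"]) (auto simp: munit_index intro!: eq_matI)

text \<open>A cyclic shift permutes \<open>{..<m}\<close>: two indices with the same image differ by
  a multiple of \<open>m\<close> smaller than \<open>m\<close>.\<close>

lemma sum_shift_mod:
  fixes f :: "nat \<Rightarrow> 'a::comm_monoid_add"
  shows "(\<Sum>i<m. f ((i + c) mod m)) = (\<Sum>j<m. f j)"
proof -
  have "inj_on (\<lambda>i. (i + c) mod m) {..<m}"
  proof (rule linorder_inj_onI)
    fix i j assume ij: "i < j" "i \<in> {..<m}" "j \<in> {..<m}"
    show "(i + c) mod m \<noteq> (j + c) mod m"
    proof
      assume "(i + c) mod m = (j + c) mod m"
      then have "m dvd (j + c) - (i + c)"
        using ij mod_eq_dvd_iff_nat[of "i + c" "j + c" m] by simp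
      then have "m dvd j - i" by simp
      then show False
        using ij dvd_imp_le[of m "j - i"] by auto
    qed
  qed (rule linear)
  moreover have "(\<lambda>i. (i + c) mod m) ` {..<m} \<subseteq> {..<m}"
    by auto
  ultimately have "bij_betw (\<lambda>i. (i + c) mod m) {..<m} {..<m}"
    by (simp add: bij_betw_def endo_inj_surj)
  then show ?thesis by (rule sum.reindex_bij_betw)
qed

text \<open>The positions of one permutation matrix in each block of \<open>B\<close>. As
  \<open>c k\<close> runs through \<open>{..<n k}\<close>, these patterns partition all positions of
  block \<open>k\<close>, which permits averaging over shifts.\<close>

definition shift_graph :: "(nat \<Rightarrow> nat) \<Rightarrow> nat set \<Rightarrow> (nat \<Rightarrow> nat) \<Rightarrow> (nat \<times> nat \<times> nat) set" where
  "shift_graph n B c = (\<lambda>(k, i). (k, i, (i + c k) mod n k)) ` (SIGMA k:B. {..<n k})"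

lemma signed_shift_block_isometry:
  assumes s: "\<And>t. s t = 1 \<or> s t = (- 1 :: real)"
  shows "block_isometry n B (mcomb n (shift_graph n B c) (\<lambda>k i j. of_real (s (k, i))))"
proof -
  define u where "u = mcomb n (shift_graph n B c) (\<lambda>k i j. of_real (s (k, i)))"
  have u: "u k \<in> carrier_mat (n k) (n k)" for k
    by (simp add: u_def mcomb_def)
  have entry: "u k $$ (i, j) = (if k \<in> B \<and> j = (i + c k) mod n k then of_real (s (k, i)) else 0)"
    if "i < n k" "j < n k" for k i j
    using that by (auto simp: u_def mcomb_def shift_graph_def)
  have ss: "complex_of_real (s t) * complex_of_real (s t) = 1" for t
    using s[of t] by auto
  have "mat_adjoint (u k) * u k = dproj n (blocks B) k" for k
  proof (rule eq_matI)
    fix j l assume "j < dim_row (dproj n (blocks B) k)" "l < dim_col (dproj n (blocks B) k)"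
    then have jl: "j < n k" "l < n k" by (auto simp: dproj_def)
    have "(mat_adjoint (u k) * u k) $$ (j, l) = (\<Sum>i<n k. mat_adjoint (u k) $$ (j, i) * u k $$ (i, l))"
      by (rule index_mult_sum[OF dim_mat_adjoint[OF u] u jl])
    \<comment> \<open>Row \<open>i\<close> has its only entry in column
      \<open>(i + c k) mod n k\<close>, and the sign squares to 1, so the summand depends on
      \<open>i\<close> only through that column.\<close>
    also have "\<dots> = (\<Sum>i<n k. (\<lambda>m. if m = j then (if k \<in> B \<and> j = l then 1 else 0) else 0) ((i + c k) mod n k))"
      using jl by (intro sum.cong) (auto simp: index_mat_adjoint[OF u] entry ss)
    also have "\<dots> = (\<Sum>m<n k. if m = j then (if k \<in> B \<and> j = l then 1 else 0) else 0)"
      by (rule sum_shift_mod)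
    also have "\<dots> = dproj n (blocks B) k $$ (j, l)"
      using jl by (simp add: dproj_def blocks_def)
    finally show "(mat_adjoint (u k) * u k) $$ (j, l) = dproj n (blocks B) k $$ (j, l)" .
  qed (use dim_mat_adjoint[OF u[of k]] u[of k] in \<open>auto simp: dproj_def\<close>)
  then show ?thesis
    unfolding u_def[symmetric] block_isometry_def using u by blast
qed

section \<open>The projection-valued measure of a normal embedding\<close>

locale normal_block_embedding =
  fixes n :: "nat \<Rightarrow> nat" and \<Phi> :: "(nat \<Rightarrow> complex mat) \<Rightarrow> ('x::metric_space ell2 \<Rightarrow>\<^sub>L 'x ell2)"
  assumes embedding: "normal_embedding n \<Phi>"
begin

lemma hom: "star_hom n \<Phi>" and quasi_local: "a \<in> mprod n \<Longrightarrow> \<Phi> a \<in> quasi_local"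
  and normal: "normal_map n \<Phi>"
  using embedding unfolding normal_embedding_def by auto

lemma Phi_mult: "a \<in> mprod n \<Longrightarrow> b \<in> mprod n \<Longrightarrow> \<Phi> (\<lambda>k. a k * b k) = \<Phi> a o\<^sub>L \<Phi> b"
  using hom unfolding star_hom_def by blast

lemma Phi_add: "a \<in> mprod n \<Longrightarrow> b \<in> mprod n \<Longrightarrow> \<Phi> (\<lambda>k. a k + b k) = \<Phi> a + \<Phi> b"
  using hom unfolding star_hom_def by blast

lemma Phi_smult: "a \<in> mprod n \<Longrightarrow> blinfun_apply (\<Phi> (\<lambda>k. c \<cdot>\<^sub>m a k)) f = c *\<^sub>C blinfun_apply (\<Phi> a) f"
  using hom unfolding star_hom_def by blast

lemma Phi_adjoint:
  "a \<in> mprod n \<Longrightarrow>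
    cinner (blinfun_apply (\<Phi> a) f) g = cinner f (blinfun_apply (\<Phi> (\<lambda>k. mat_adjoint (a k))) g)"
  using hom unfolding star_hom_def is_adjoint_def by blast

lemma Phi_bounded: "a \<in> mprod n \<Longrightarrow> \<Phi> a \<in> bounded_ops"
  using hom unfolding star_hom_def by blast

text \<open>A finitely additive projection-valued measure; taking arbitrary sets of pairs lets
  single diagonal units, blocks and tails be handled alike.\<close>

definition proj :: "(nat \<times> nat) set \<Rightarrow> 'x ell2 \<Rightarrow> 'x ell2" where
  "proj W = blinfun_apply (\<Phi> (dproj n W))"

lemma proj_linear: "bounded_linear (proj W)"
  unfolding proj_def by (rule blinfun.bounded_linear_right)

lemmas proj_add = linear_add[OF bounded_linear.linear[OF proj_linear]]
  and proj_scaleR = linear_scale[OF bounded_linear.linear[OF proj_linear]]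

lemma proj_scaleC: "proj W (c *\<^sub>C f) = c *\<^sub>C proj W f"
  using Phi_bounded[OF dproj_mprod[of n W]] by (simp add: proj_def bounded_ops_def)

lemma Phi_dproj_comp: "\<Phi> (dproj n W) o\<^sub>L \<Phi> (dproj n V) = \<Phi> (dproj n (W \<inter> V))"
  by (simp add: Phi_mult[symmetric] dproj_mprod dproj_mult)

lemma proj_proj: "proj W (proj V f) = proj (W \<inter> V) f"
  unfolding proj_def Phi_dproj_comp[symmetric] by simp

lemma proj_Un: "W \<inter> V = {} \<Longrightarrow> proj (W \<union> V) f = proj W f + proj V f"
proof -
  assume "W \<inter> V = {}"
  then have "\<Phi> (dproj n (W \<union> V)) = \<Phi> (dproj n W) + \<Phi> (dproj n V)"
    by (simp add: Phi_add[symmetric] dproj_mprod dproj_Un)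
  then show ?thesis by (simp add: proj_def blinfun.add_left)
qed

lemma proj_empty: "proj {} f = 0"
  using proj_Un[of "{}" "{}" f] by simp

lemma Phi_dproj_empty: "\<Phi> (dproj n {}) = 0"
  using proj_empty unfolding proj_def by (intro blinfun_eqI) simp

lemma proj_adjoint: "cinner (proj W f) g = cinner f (proj W g)"
  by (simp add: proj_def Phi_adjoint dproj_mprod dproj_adjoint)

lemma cinner_proj_self: "cinner (proj W f) f = of_real ((norm (proj W f))\<^sup>2)"
proof -
  have "cinner (proj W f) f = cinner (proj W (proj W f)) f"
    by (simp add: proj_proj)
  also have "\<dots> = cinner (proj W f) (proj W f)"
    by (rule proj_adjoint)
  finally show ?thesis by (simp only: cinner_norm)
qed

text \<open>By \<open>cinner_proj_self\<close> the squared norm is linear in the projection, so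
  additivity of \<open>proj\<close> becomes the theorem of Pythagoras.\<close>

lemma norm_proj_Un:
  assumes "W \<inter> V = {}"
  shows "(norm (proj (W \<union> V) f))\<^sup>2 = (norm (proj W f))\<^sup>2 + (norm (proj V f))\<^sup>2"
proof -
  have "complex_of_real ((norm (proj (W \<union> V) f))\<^sup>2) =
      complex_of_real ((norm (proj W f))\<^sup>2 + (norm (proj V f))\<^sup>2)"
    unfolding of_real_add cinner_proj_self[symmetric] by (simp add: proj_Un[OF assms] cinner_add_left)
  then show ?thesis by (simp only: of_real_eq_iff)
qed

lemma norm_proj_mono:
  assumes "W \<subseteq> V"
  shows "norm (proj W f) \<le> norm (proj V f)"
proof -
  have "W \<union> (V - W) = V" using assms by blast
  then have "(norm (proj W f))\<^sup>2 \<le> (norm (proj V f))\<^sup>2"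
    using norm_proj_Un[of W "V - W" f] by simp
  then show ?thesis by (rule power2_le_imp_le) simp
qed

lemma norm_proj_le: "norm (proj W f) \<le> norm f"
proof -
  have "(norm (proj W f))\<^sup>2 = cmod (cinner (proj W f) f)"
    unfolding cinner_proj_self norm_of_real by simp
  also have "\<dots> \<le> norm (proj W f) * norm f"
    by (rule cmod_cinner_le)
  finally have "norm (proj W f) * norm (proj W f) \<le> norm (proj W f) * norm f"
    by (simp add: power2_eq_square)
  then show ?thesis
    by (cases "norm (proj W f) = 0") (auto simp: mult_le_cancel_left)
qed

lemma norm_proj_diff:
  assumes "W \<subseteq> V"
  shows "(norm (proj V f - proj W f))\<^sup>2 = (norm (proj V f))\<^sup>2 - (norm (proj W f))\<^sup>2"
proof -
  have V: "W \<union> (V - W) = V" using assms by blast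
  have "proj V f - proj W f = proj (V - W) f"
    using proj_Un[of W "V - W" f] V by simp
  then show ?thesis
    using norm_proj_Un[of W "V - W" f] V by simp
qed

lemma proj_sum: "finite W \<Longrightarrow> proj W f = (\<Sum>s\<in>W. proj {s} f)"
proof (induction W rule: finite_induct)
  case (insert s W)
  then show ?case using proj_Un[of "{s}" W f] by simp
qed (simp add: proj_empty)

lemma norm_proj_sum: "finite W \<Longrightarrow> (norm (proj W f))\<^sup>2 = (\<Sum>s\<in>W. (norm (proj {s} f))\<^sup>2)"
proof (induction W rule: finite_induct)
  case (insert s W)
  then show ?case using norm_proj_Un[of "{s}" W f] by simp
qed (simp add: proj_empty)

text \<open>\<open>\<Phi>\<close> sends \<open>u* u\<close> to the projection onto the blocks in
  \<open>A\<close>. This transfers estimates for a cleverly chosen \<open>u\<close> to the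
  projection itself.\<close>

lemma norm_block_isometry:
  assumes u: "block_isometry n A u"
  shows "norm (blinfun_apply (\<Phi> u) f) = norm (proj (blocks A) f)"
proof -
  have "dproj n (blocks A) = (\<lambda>k. mat_adjoint (u k) * u k)"
    using u unfolding block_isometry_def by (intro ext) simp
  then have "proj (blocks A) f = blinfun_apply (\<Phi> (\<lambda>k. mat_adjoint (u k))) (blinfun_apply (\<Phi> u) f)"
    by (simp add: proj_def Phi_mult[OF block_isometry_adjoint_mprod[OF u] block_isometry_mprod[OF u]])
  then have "cinner (blinfun_apply (\<Phi> u) f) (blinfun_apply (\<Phi> u) f) = cinner f (proj (blocks A) f)"
    using Phi_adjoint[OF block_isometry_mprod[OF u]] by simp
  also have "\<dots> = of_real ((norm (proj (blocks A) f))\<^sup>2)"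
    unfolding proj_adjoint[symmetric] by (rule cinner_proj_self)
  finally have "(norm (blinfun_apply (\<Phi> u) f))\<^sup>2 = (norm (proj (blocks A) f))\<^sup>2"
    unfolding cinner_norm by (simp only: of_real_eq_iff)
  then show ?thesis by (simp add: power2_eq_iff_nonneg)
qed

section \<open>Normality and strong convergence of the block projections\<close>

text \<open>The squared norms increase and are bounded, hence Cauchy, and by Pythagoras their
  differences are the squared distances of the vectors.\<close>

lemma proj_blocks_convergent: "convergent (\<lambda>K. proj (blocks {..<K}) f)"
proof (rule Cauchy_convergent, rule CauchyI')
  let ?a = "\<lambda>K. (norm (proj (blocks {..<K}) f))\<^sup>2"
  have mono: "incseq ?a"
    by (intro incseq_SucI power_mono norm_proj_mono) (auto simp: blocks_def)
  have le: "\<forall>K. ?a K \<le> (norm f)\<^sup>2"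
    by (intro allI power_mono norm_proj_le norm_ge_zero)
  obtain L where "?a \<longlonglongrightarrow> L"
    using incseq_convergent[OF mono le] by blast
  then have C: "Cauchy ?a"
    by (rule LIMSEQ_imp_Cauchy)
  fix e :: real assume e: "0 < e"
  then obtain M where M: "\<And>m k. m \<ge> M \<Longrightarrow> k \<ge> M \<Longrightarrow> \<bar>?a m - ?a k\<bar> < e\<^sup>2"
    using CauchyD[OF C, of "e\<^sup>2"] by (metis real_norm_def zero_less_power)
  have "dist (proj (blocks {..<m}) f) (proj (blocks {..<k}) f) < e" if "m \<ge> M" "m < k" for m k
  proof -
    have "(norm (proj (blocks {..<k}) f - proj (blocks {..<m}) f))\<^sup>2 = ?a k - ?a m"
      using that by (intro norm_proj_diff) (auto simp: blocks_def)
    also have "\<dots> < e\<^sup>2"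
      using M[of k m] that by linarith
    finally show ?thesis
      using e unfolding dist_norm norm_minus_commute[of "proj (blocks {..<m}) f"]
      by (rule power2_less_imp_less[OF _ less_imp_le])
  qed
  then show "\<exists>M. \<forall>m\<ge>M. \<forall>k>m. dist (proj (blocks {..<m}) f) (proj (blocks {..<k}) f) < e"
    by blast
qed

lemma Phi_UNIV_supremum:
  "is_supremum bounded_ops op_le (range (\<lambda>K. \<Phi> (dproj n (blocks {..<K})))) (\<Phi> (dproj n UNIV))"
proof -
  (* normal_map only admits index sets of elements of the product, so K is coded as a constant sequence *)
  define code :: "nat \<Rightarrow> nat \<Rightarrow> complex mat" where "code K = (\<lambda>_. 0\<^sub>m K K)" for K
  define decode :: "(nat \<Rightarrow> complex mat) \<Rightarrow> nat" where "decode c = dim_row (c 0)" for c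
  have dc: "decode (code K) = K" for K
    by (simp add: code_def decode_def)
  define leq where "leq c d \<longleftrightarrow> decode c \<le> decode d" for c d
  define a where "a c = dproj n (blocks {..<decode c})" for c
  have img: "a ` range code = range (\<lambda>K. dproj n (blocks {..<K}))"
    "(\<lambda>i. \<Phi> (a i)) ` range code = range (\<lambda>K. \<Phi> (dproj n (blocks {..<K})))"
    unfolding a_def image_image dc by simp_all
  have "directed_index (range code) leq"
    unfolding directed_index_def leq_def by (auto simp: dc) (metis linear order_refl)
  moreover have "\<forall>i\<in>range code. a i \<in> mprod n \<and> mprod_le n (mprod_zero n) (a i)"
  proof -
    have "mprod_zero n = dproj n {}"
      unfolding mprod_zero_def dproj_def by (intro ext eq_matI) auto
    then show ?thesis
      by (simp add: a_def dproj_mprod dproj_le)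
  qed
  moreover have "\<forall>i\<in>range code. \<forall>j\<in>range code. leq i j \<longrightarrow> mprod_le n (a i) (a j)"
    unfolding a_def leq_def by (auto intro!: dproj_le simp: blocks_def)
  moreover have "\<exists>C. \<forall>i\<in>range code. mprod_norm (a i) \<le> C"
  proof (intro exI ballI)
    fix i show "mprod_norm (a i) \<le> 1"
      unfolding mprod_norm_def a_def
      by (intro cSUP_least block_isometry_opnorm[OF block_isometry_dproj]) simp
  qed
  moreover have "is_supremum (mprod n) (mprod_le n) (a ` range code) (dproj n UNIV)"
    unfolding img by (rule dproj_UNIV_supremum)
  ultimately show ?thesis
    using normal unfolding normal_map_def img(2)[symmetric] by blast
qed

text \<open>The strong limit of the projections onto finitely many blocks is an upper bound of them, so
  by normality it dominates \<open>\<Phi> 1\<close>.\<close>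

lemma proj_blocks_tendsto: "(\<lambda>K. proj (blocks {..<K}) f) \<longlonglongrightarrow> proj UNIV f"
proof -
  define P where "P f = lim (\<lambda>K. proj (blocks {..<K}) f)" for f
  have P: "(\<lambda>K. proj (blocks {..<K}) f) \<longlonglongrightarrow> P f" for f
    using proj_blocks_convergent[of f] unfolding P_def convergent_LIMSEQ_iff .
  have lin: "bounded_linear P"
  proof (rule bounded_linear_intro[where K = 1])
    fix f g and r :: real
    show "P (f + g) = P f + P g"
      using P[of "f + g"] tendsto_add[OF P[of f] P[of g]] unfolding proj_add by (rule LIMSEQ_unique)
    show "P (r *\<^sub>R f) = r *\<^sub>R P f"
      using P[of "r *\<^sub>R f"] tendsto_scaleR[OF tendsto_const P[of f]] unfolding proj_scaleR
      by (rule LIMSEQ_unique)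
    show "norm (P f) \<le> norm f * 1"
      by (rule LIMSEQ_le_const2[OF tendsto_norm[OF P]]) (use norm_proj_le in auto)
  qed
  define p where "p = Blinfun P"
  have p: "blinfun_apply p = P"
    unfolding p_def using lin by (rule bounded_linear_Blinfun_apply)
  \<comment> \<open>The construction of \<open>p\<close> yields real linearity only, whereas the
    supremum is taken among the complex-linear operators.\<close>
  have P_scaleC: "P (c *\<^sub>C f) = c *\<^sub>C P f" for c f
  proof -
    have "bounded_linear (\<lambda>f :: 'x ell2. c *\<^sub>C f)"
      by (rule bounded_linear_intro[where K = "cmod c"])
        (auto intro!: ell2_eqI simp: scaleC.rep_eq plus_ell2.rep_eq scaleR_ell2.rep_eq algebra_simps norm_scaleC)
    then have "(\<lambda>K. c *\<^sub>C proj (blocks {..<K}) f) \<longlonglongrightarrow> c *\<^sub>C P f"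
      by (rule bounded_linear.tendsto[OF _ P])
    with P[of "c *\<^sub>C f"] show ?thesis
      unfolding proj_scaleC by (rule LIMSEQ_unique)
  qed
  then have "p \<in> bounded_ops"
    by (simp add: bounded_ops_def p)
  have cinner_P: "cinner (P f) f = of_real ((norm (P f))\<^sup>2)" for f
  proof (rule LIMSEQ_unique[of "\<lambda>K. cinner (proj (blocks {..<K}) f) f"])
    have "bounded_linear (\<lambda>g. cinner g f)"
      by (rule bounded_linear_intro[where K = "norm f"])
        (auto simp: cinner_add_left scaleR_scaleC cinner_scaleC_left scaleR_conv_of_real cmod_cinner_le)
    then show "(\<lambda>K. cinner (proj (blocks {..<K}) f) f) \<longlonglongrightarrow> cinner (P f) f"
      by (rule bounded_linear.tendsto[OF _ P])
    show "(\<lambda>K. cinner (proj (blocks {..<K}) f) f) \<longlonglongrightarrow> of_real ((norm (P f))\<^sup>2)"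
      unfolding cinner_proj_self by (intro tendsto_of_real tendsto_power tendsto_norm P)
  qed
  have le: "norm (proj (blocks {..<K}) f) \<le> norm (P f)" for K f
  proof (rule incseq_le[OF _ tendsto_norm[OF P]])
    show "incseq (\<lambda>K. norm (proj (blocks {..<K}) f))"
      by (intro incseq_SucI norm_proj_mono) (auto simp: blocks_def)
  qed
  have "op_le (\<Phi> (dproj n (blocks {..<K}))) p" for K
    unfolding op_le_def
  proof
    fix f
    have "cinner (blinfun_apply (p - \<Phi> (dproj n (blocks {..<K}))) f) f =
        of_real ((norm (P f))\<^sup>2 - (norm (proj (blocks {..<K}) f))\<^sup>2)"
      by (simp add: blinfun.diff_left p proj_def[symmetric] cinner_diff_left cinner_P cinner_proj_self)
    moreover have "(norm (proj (blocks {..<K}) f))\<^sup>2 \<le> (norm (P f))\<^sup>2"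
      by (intro power_mono le) simp
    ultimately show "0 \<le> cinner (blinfun_apply (p - \<Phi> (dproj n (blocks {..<K}))) f) f"
      by (simp add: less_eq_complex_def)
  qed
  then have "op_le (\<Phi> (dproj n UNIV)) p"
    using Phi_UNIV_supremum \<open>p \<in> bounded_ops\<close> unfolding is_supremum_def by blast
  then have "0 \<le> cinner (blinfun_apply (p - \<Phi> (dproj n UNIV)) f) f"
    unfolding op_le_def by blast
  then have UNIV: "(norm (proj UNIV f))\<^sup>2 \<le> (norm (P f))\<^sup>2"
    by (simp add: blinfun.diff_left p proj_def[symmetric] cinner_diff_left cinner_P cinner_proj_self
        less_eq_complex_def)
  \<comment> \<open>By Pythagoras the squared distance is the difference of squared norms, and by
    \<open>UNIV\<close> it is at most that of \<open>P f\<close> minus that of the partial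
    projection, which tends to 0.\<close>
  have "(\<lambda>K. norm (proj UNIV f - proj (blocks {..<K}) f)) \<longlonglongrightarrow> 0"
  proof (rule tendsto_sandwich[OF _ _ tendsto_const])
    show "(\<lambda>K. sqrt ((norm (P f))\<^sup>2 - (norm (proj (blocks {..<K}) f))\<^sup>2)) \<longlonglongrightarrow> 0"
    proof -
      have "(\<lambda>K. sqrt ((norm (P f))\<^sup>2 - (norm (proj (blocks {..<K}) f))\<^sup>2))
          \<longlonglongrightarrow> sqrt ((norm (P f))\<^sup>2 - (norm (P f))\<^sup>2)"
        by (intro tendsto_real_sqrt tendsto_diff tendsto_power tendsto_norm tendsto_const P)
      then show ?thesis by simp
    qed
    have "norm (proj UNIV f - proj (blocks {..<K}) f)
        \<le> sqrt ((norm (P f))\<^sup>2 - (norm (proj (blocks {..<K}) f))\<^sup>2)" for K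
      using norm_proj_diff[of "blocks {..<K}" UNIV f] UNIV by (intro real_le_rsqrt) simp
    then show "\<forall>\<^sub>F K in sequentially. norm (proj UNIV f - proj (blocks {..<K}) f)
        \<le> sqrt ((norm (P f))\<^sup>2 - (norm (proj (blocks {..<K}) f))\<^sup>2)"
      by simp
  qed simp
  then have "(\<lambda>K. proj UNIV f - proj (blocks {..<K}) f) \<longlonglongrightarrow> 0"
    by (rule tendsto_norm_zero_cancel)
  from tendsto_diff[OF tendsto_const this, of "proj UNIV f"] show ?thesis by simp
qed

text \<open>All later arguments use normality through this limit only.\<close>

lemma proj_tail_tendsto: "(\<lambda>K. norm (proj (blocks {K..}) f)) \<longlonglongrightarrow> 0"
proof -
  have split: "proj UNIV f = proj (blocks {..<K}) f + proj (blocks {K..}) f" for K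
  proof -
    have "blocks {..<K} \<union> blocks {K..} = UNIV" "blocks {..<K} \<inter> blocks {K..} = {}"
      by (auto simp: blocks_def)
    then show ?thesis using proj_Un by metis
  qed
  have "proj (blocks {K..}) f = proj UNIV f - proj (blocks {..<K}) f" for K
    unfolding split[of K] by simp
  then show ?thesis
    using tendsto_norm_zero[OF LIM_zero[OF proj_blocks_tendsto[of f]]]
    by (simp add: norm_minus_commute)
qed

section \<open>Images of the matrix units\<close>

definition eunit :: "nat \<Rightarrow> nat \<Rightarrow> nat \<Rightarrow> 'x ell2 \<Rightarrow> 'x ell2" where
  "eunit k i j = blinfun_apply (\<Phi> (munit n k (Suc i) (Suc j)))"

text \<open>The vector \<open>eunit k i j f\<close> has the norm of
  \<open>proj {(Suc j, k)} f\<close> and lies in the range of the \<open>i\<close>-th diagonal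
  projection, so \<open>delta y\<close> may be replaced by its projection before Cauchy-Schwarz is
  applied. That second factor is what remains summable over \<open>i\<close>.\<close>

lemma eunit_entry_le:
  assumes "i < n k"
  shows "cmod (ell2_apply (eunit k i j f) y) \<le> norm (proj {(Suc j, k)} f) * norm (proj {(Suc i, k)} (delta y))"
proof -
  let ?e = "munit n k (Suc i) (Suc j)"
  have mult: "eunit k l i (eunit k i j f) = eunit k l j f" for l
    unfolding eunit_def blinfun_apply_blinfun_compose[symmetric] Phi_mult[OF munit_mprod munit_mprod, symmetric]
      munit_mult[of i n k, OF assms] by (rule refl)
  have proj: "proj {(Suc l, k)} = eunit k l l" for l
    by (simp add: proj_def eunit_def munit_dproj)
  have "eunit k j i (eunit k i j f) = proj {(Suc j, k)} f"
    by (simp only: mult proj)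
  then have "cinner (eunit k i j f) (eunit k i j f) = cinner f (proj {(Suc j, k)} f)"
    unfolding eunit_def Phi_adjoint[OF munit_mprod] munit_adjoint by simp
  also have "\<dots> = of_real ((norm (proj {(Suc j, k)} f))\<^sup>2)"
    unfolding proj_adjoint[symmetric] by (rule cinner_proj_self)
  finally have "(norm (eunit k i j f))\<^sup>2 = (norm (proj {(Suc j, k)} f))\<^sup>2"
    unfolding cinner_norm by (simp only: of_real_eq_iff)
  then have norm: "norm (eunit k i j f) = norm (proj {(Suc j, k)} f)"
    by (simp only: power2_eq_iff_nonneg norm_ge_zero)
  have "proj {(Suc i, k)} (eunit k i j f) = eunit k i j f"
    by (simp only: mult proj)
  then have "ell2_apply (eunit k i j f) y = cinner (eunit k i j f) (proj {(Suc i, k)} (delta y))"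
    unfolding proj_adjoint[symmetric] by (simp add: cinner_delta)
  then show ?thesis
    using cmod_cinner_le[of "eunit k i j f" "proj {(Suc i, k)} (delta y)"] norm by simp
qed

lemma Phi_mcomb:
  "finite W \<Longrightarrow> blinfun_apply (\<Phi> (mcomb n W g)) f = (\<Sum>(k, i, j)\<in>W. g k i j *\<^sub>C eunit k i j f)"
proof (induction W rule: finite_induct)
  case empty
  have "mcomb n {} g = dproj n {}"
    by (simp add: mcomb_def dproj_def)
  then show ?case by (simp add: Phi_dproj_empty)
next
  case (insert t W)
  obtain k i j where t: "t = (k, i, j)" by (metis prod_cases3)
  have "\<Phi> (mcomb n (insert t W) g) =
      \<Phi> (mcomb n W g) + \<Phi> (\<lambda>k'. g k i j \<cdot>\<^sub>m munit n k (Suc i) (Suc j) k')"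
    unfolding t mcomb_insert[OF insert.hyps(2)[unfolded t]]
    by (rule Phi_add[OF mcomb_mprod[OF insert.hyps(1)] smult_munit_mprod])
  then have "blinfun_apply (\<Phi> (mcomb n (insert t W) g)) f =
      blinfun_apply (\<Phi> (mcomb n W g)) f + g k i j *\<^sub>C eunit k i j f"
    by (simp add: blinfun.add_left Phi_smult[OF munit_mprod] eunit_def)
  then show ?case
    using insert by (simp add: t add.commute)
qed

lemma Phi_proj: "a \<in> mprod n \<Longrightarrow> blinfun_apply (\<Phi> a) (proj W f) = blinfun_apply (\<Phi> (\<lambda>k. a k * dproj n W k)) f"
  by (simp add: Phi_mult dproj_mprod proj_def)

lemma Phi_proj_blocks:
  assumes u: "block_isometry n A u" and B: "finite B"
  shows "blinfun_apply (\<Phi> u) (proj (blocks B) f) =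
    (\<Sum>(k, i, j)\<in>(SIGMA k:B. {..<n k} \<times> {..<n k}). u k $$ (i, j) *\<^sub>C eunit k i j f)"
proof -
  let ?W = "SIGMA k:B. {..<n k} \<times> {..<n k}"
  have "(\<lambda>k. u k * dproj n (blocks B) k) = mcomb n ?W (\<lambda>k i j. u k $$ (i, j))"
  proof
    fix k
    show "u k * dproj n (blocks B) k = mcomb n ?W (\<lambda>k i j. u k $$ (i, j)) k"
    proof (cases "k \<in> B")
      case True
      then show ?thesis
        using block_isometry_carrier[OF u, of k] unfolding dproj_blocks
        by (intro eq_matI) (auto simp: mcomb_def)
    next
      case False
      then have "u k * dproj n (blocks B) k = 0\<^sub>m (n k) (n k)"
        using block_isometry_carrier[OF u, of k] by (simp add: dproj_blocks)
      then show ?thesis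
        using False by (auto simp: mcomb_def intro!: eq_matI)
    qed
  qed
  then show ?thesis
    using Phi_proj[OF block_isometry_mprod[OF u], of "blocks B" f] B Phi_mcomb[of ?W] by simp
qed

section \<open>Uniform quasi-locality of block isometries\<close>

definition far :: "real \<Rightarrow> 'x \<Rightarrow> 'x set" where
  "far r x = {y. r < dist x y}"

text \<open>Stated for all large radii, so that finitely many operators can share one radius and the
  radius can be made as large as desired.\<close>

lemma quasi_local_far:
  assumes a: "a \<in> quasi_local" and e: "0 < e"
  shows "\<forall>\<^sub>F r in at_top. \<forall>x. norm (blinfun_apply (chi (far r x)) (blinfun_apply a (delta x))) \<le> e"
proof -
  obtain r0 where r0: "\<And>A B. setdist A B > r0 \<Longrightarrow> norm (chi A o\<^sub>L a o\<^sub>L chi B) \<le> e"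
    using a e unfolding quasi_local_def by blast
  show ?thesis
    using eventually_gt_at_top[of r0]
  proof eventually_elim
    case (elim r)
    show ?case
    proof
      fix x
      show "norm (blinfun_apply (chi (far r x)) (blinfun_apply a (delta x))) \<le> e"
      \<comment> \<open>For an empty set \<open>setdist\<close> is 0, so the quasi-locality
        condition gives nothing there; instead the cut-off operator vanishes.\<close>
      proof (cases "far r x = {}")
        case True
        then show ?thesis using e by (simp add: chi_empty)
      next
        case False
        have "r \<le> setdist (far r x) {x}"
          using False by (intro le_setdistI) (auto simp: far_def dist_commute)
        then have "norm (chi (far r x) o\<^sub>L a o\<^sub>L chi {x}) \<le> e"
          using elim by (intro r0) simp
        moreover have "norm (blinfun_apply (chi (far r x) o\<^sub>L a o\<^sub>L chi {x}) (delta x))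
            \<le> norm (chi (far r x) o\<^sub>L a o\<^sub>L chi {x}) * norm (delta x)"
          by (rule norm_blinfun)
        ultimately show ?thesis
          by (simp add: norm_delta chi_delta)
      qed
    qed
  qed
qed

text \<open>Finitely many blocks contain finitely many matrix units, each of them quasi-local, and
  every block isometry combines these with coefficients of modulus at most 1. Hence one radius
  serves all isometries.\<close>

lemma head_quasi_local:
  assumes B: "finite B" and e: "0 < e"
  shows "\<forall>\<^sub>F r in at_top. \<forall>A u x. block_isometry n A u \<longrightarrow>
    norm (blinfun_apply (chi (far r x)) (blinfun_apply (\<Phi> u) (proj (blocks B) (delta x)))) \<le> e"
proof -
  define W where "W = (SIGMA k:B. {..<n k} \<times> {..<n k})"
  \<comment> \<open>An error \<open>d\<close> for each of the \<open>card W\<close> units adds up to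
    at most \<open>e\<close>; the \<open>+ 1\<close> keeps the denominator positive when
    \<open>W\<close> is empty.\<close>
  define d where "d = e / (real (card W) + 1)"
  have W: "finite W"
    using B by (simp add: W_def)
  have d: "0 < d" and Wd: "real (card W) * d \<le> e"
    using e by (simp_all add: d_def add_nonneg_pos divide_le_eq mult.commute)
  have "\<forall>\<^sub>F r in at_top. \<forall>t\<in>W. \<forall>x. case t of (k, i, j) \<Rightarrow>
      norm (blinfun_apply (chi (far r x)) (eunit k i j (delta x))) \<le> d"
    using W
  proof (rule eventually_ball_finite, intro ballI)
    fix t assume "t \<in> W"
    obtain k i j where t: "t = (k, i, j)" by (metis prod_cases3)
    show "\<forall>\<^sub>F r in at_top. \<forall>x. case t of (k, i, j) \<Rightarrow>
      norm (blinfun_apply (chi (far r x)) (eunit k i j (delta x))) \<le> d"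
      unfolding t prod.case eunit_def by (rule quasi_local_far[OF quasi_local[OF munit_mprod] d])
  qed
  then show ?thesis
  proof eventually_elim
    case (elim r)
    show ?case
    proof (intro allI impI)
      fix A u x assume u: "block_isometry n A u"
      let ?h = "blinfun_apply (chi (far r x))"
      have "?h (blinfun_apply (\<Phi> u) (proj (blocks B) (delta x))) =
          (\<Sum>t\<in>W. case t of (k, i, j) \<Rightarrow> u k $$ (i, j) *\<^sub>C ?h (eunit k i j (delta x)))"
        unfolding Phi_proj_blocks[OF u B] W_def[symmetric]
        by (simp add: blinfun.sum_right chi_scaleC split_beta)
      also have "norm \<dots> \<le> (\<Sum>t\<in>W. d)"
      proof (rule sum_norm_le)
        fix t assume t: "t \<in> W"
        obtain k i j where kij: "t = (k, i, j)" by (metis prod_cases3)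
        have "norm (u k $$ (i, j) *\<^sub>C ?h (eunit k i j (delta x))) \<le> 1 * d"
          unfolding norm_scaleC
        proof (rule mult_mono)
          show "cmod (u k $$ (i, j)) \<le> 1"
            using t kij by (intro block_isometry_entry_le[OF u]) (auto simp: W_def)
          show "norm (?h (eunit k i j (delta x))) \<le> d"
            using elim t kij by auto
        qed simp_all
        then show "norm (case t of (k, i, j) \<Rightarrow> u k $$ (i, j) *\<^sub>C ?h (eunit k i j (delta x))) \<le> d"
          by (simp add: kij)
      qed
      also have "\<dots> \<le> e"
        using Wd by simp
      finally show "norm (?h (blinfun_apply (\<Phi> u) (proj (blocks B) (delta x)))) \<le> e" .
    qed
  qed
qed

lemma norm_block_isometry_le: "block_isometry n A u \<Longrightarrow> norm (blinfun_apply (\<Phi> u) f) \<le> norm f"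
  by (simp add: norm_block_isometry norm_proj_le)

lemma Phi_split:
  assumes "block_isometry n A u" "K \<le> L"
  shows "blinfun_apply (\<Phi> u) f = blinfun_apply (\<Phi> u) (proj (blocks {..<K}) f) +
    blinfun_apply (\<Phi> u) (proj (blocks {K..<L}) f) + blinfun_apply (\<Phi> u) (proj (blocks {L..}) f)"
proof -
  have "u k * dproj n (blocks UNIV) k = u k" for k
    using block_isometry_carrier[OF assms(1), of k] by (simp add: dproj_blocks)
  then have "blinfun_apply (\<Phi> u) f = blinfun_apply (\<Phi> u) (proj UNIV f)"
    using Phi_proj[OF block_isometry_mprod[OF assms(1)], of "blocks UNIV" f] by (simp add: blocks_simps)
  moreover have "UNIV = blocks {..<L} \<union> blocks {L..}" "blocks {..<L} \<inter> blocks {L..} = {}"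
    "blocks {..<L} = blocks {..<K} \<union> blocks {K..<L}" "blocks {..<K} \<inter> blocks {K..<L} = {}"
    using assms(2) by (auto simp: blocks_def)
  then have "proj UNIV f = proj (blocks {..<K}) f + proj (blocks {K..<L}) f + proj (blocks {L..}) f"
    by (metis proj_Un)
  ultimately show ?thesis
    by (simp add: blinfun.add_right)
qed

text \<open>A gliding hump: finitely many blocks are uniformly quasi-local, and by normality the blocks
  far out act as almost zero on a fixed basis vector. Failures of uniformity can therefore be
  arranged in disjoint ranges of blocks and glued to a single element which is not quasi-local.\<close>

lemma uniformly_quasi_local:
  assumes e: "0 < e"
  shows "\<exists>r>0. \<forall>A u x. block_isometry n A u \<longrightarrow>
    norm (blinfun_apply (chi (far r x)) (blinfun_apply (\<Phi> u) (delta x))) \<le> e"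
proof (rule ccontr)
  assume "\<not> ?thesis"
  then have bad: "\<exists>A u x. block_isometry n A u \<and>
      e < norm (blinfun_apply (chi (far r x)) (blinfun_apply (\<Phi> u) (delta x)))" if "0 < r" for r
    using that by (metis not_le)
  \<comment> \<open>A hump beyond block \<open>K\<close>: \<open>x\<close> and \<open>u\<close>
    witness a failure at radius \<open>r\<close>, the blocks below \<open>K\<close> are negligible
    at that radius, and the blocks from \<open>L\<close> on are negligible at \<open>x\<close>. Two
    witnesses will be compared, each with an error from below and one from above, so four errors of
    \<open>e / 8\<close> leave \<open>e / 2\<close>.\<close>
  define good where "good K r A u x L \<longleftrightarrow> real K \<le> r \<and> K < L \<and> block_isometry n A u \<and>
      e < norm (blinfun_apply (chi (far r x)) (blinfun_apply (\<Phi> u) (delta x))) \<and>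
      (\<forall>A u y. block_isometry n A u \<longrightarrow>
        norm (blinfun_apply (chi (far r y)) (blinfun_apply (\<Phi> u) (proj (blocks {..<K}) (delta y)))) \<le> e / 8) \<and>
      norm (proj (blocks {L..}) (delta x)) \<le> e / 8" for K :: nat and r A u x and L :: nat
  have "\<exists>r A u x L. good K r A u x L" for K
  proof -
    have "\<forall>\<^sub>F r in at_top. real K \<le> r \<and> 0 < r \<and> (\<forall>A u y. block_isometry n A u \<longrightarrow>
        norm (blinfun_apply (chi (far r y)) (blinfun_apply (\<Phi> u) (proj (blocks {..<K}) (delta y)))) \<le> e / 8)"
      using e by (intro eventually_conj head_quasi_local eventually_ge_at_top eventually_gt_at_top) auto
    then obtain r where r: "real K \<le> r" "0 < r" "\<forall>A u y. block_isometry n A u \<longrightarrow>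
        norm (blinfun_apply (chi (far r y)) (blinfun_apply (\<Phi> u) (proj (blocks {..<K}) (delta y)))) \<le> e / 8"
      using eventually_happens'[OF trivial_limit_at_top_linorder] by blast
    obtain A u x where u: "block_isometry n A u"
      "e < norm (blinfun_apply (chi (far r x)) (blinfun_apply (\<Phi> u) (delta x)))"
      using bad[OF r(2)] by blast
    have "\<forall>\<^sub>F L in sequentially. norm (proj (blocks {L..}) (delta x)) < e / 8"
      using e by (intro order_tendstoD(2)[OF proj_tail_tendsto]) simp
    then have "\<forall>\<^sub>F L in sequentially. norm (proj (blocks {L..}) (delta x)) < e / 8 \<and> K < L"
      by (intro eventually_conj eventually_gt_at_top)
    then obtain L where "norm (proj (blocks {L..}) (delta x)) < e / 8" "K < L"
      using eventually_happens'[OF sequentially_bot] by blast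
    then show ?thesis
      unfolding good_def using r u by (intro exI[of _ r] exI[of _ A] exI[of _ u] exI[of _ x] exI[of _ L]) simp
  qed
  then obtain r A u x L where good: "\<And>K. good K (r K) (A K) (u K) (x K) (L K)"
    by metis
  \<comment> \<open>Each hump starts where the tail of the preceding witness vector became
    negligible; \<open>idx k\<close> below locates the range containing block
    \<open>k\<close>.\<close>
  define M where "M j = (L ^^ j) 0" for j
  have M: "M 0 = 0" "M (Suc j) = L (M j)" for j
    by (simp_all add: M_def)
  have "M j < M (Suc j)" for j
    using good[of "M j"] by (simp add: M good_def)
  then have M_mono: "strict_mono M"
    by (simp add: strict_mono_Suc_iff)
  define idx where "idx k = (LEAST j. k < M (Suc j))" for k
  have idx: "idx k = j" if "M j \<le> k" "k < M (Suc j)" for k j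
    unfolding idx_def
  proof (rule Least_equality)
    fix i assume "k < M (Suc i)"
    then have "M j < M (Suc i)" using that(1) by simp
    then show "j \<le> i"
      using M_mono by (simp add: strict_mono_less)
  qed (rule that(2))
  \<comment> \<open>The glued element copies each block from the witness of its range. Being a block
    isometry is a blockwise condition, so it survives the gluing.\<close>
  define a where "a k = u (M (idx k)) k" for k
  define A' where "A' = {k. k \<in> A (M (idx k))}"
  have a: "block_isometry n A' a"
    unfolding block_isometry_def
  proof
    fix k
    have "block_isometry n (A (M (idx k))) (u (M (idx k)))"
      using good[of "M (idx k)"] by (simp add: good_def)
    then show "a k \<in> carrier_mat (n k) (n k) \<and> mat_adjoint (a k) * a k = dproj n (blocks A') k"
      unfolding block_isometry_def a_def dproj_blocks A'_def by simp
  qed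
  have lower: "e / 2 < norm (blinfun_apply (chi (far (r (M j)) (x (M j)))) (blinfun_apply (\<Phi> a) (delta (x (M j)))))" for j
  proof -
    define K y v where "K = M j" and "y = x K" and "v = u K"
    have g: "K < L K" "block_isometry n (A K) v"
      "e < norm (blinfun_apply (chi (far (r K) y)) (blinfun_apply (\<Phi> v) (delta y)))"
      "norm (proj (blocks {L K..}) (delta y)) \<le> e / 8"
      using good[of K] by (simp_all add: good_def y_def v_def)
    \<comment> \<open>Both the glued element and the witness need this bound; since \<open>a\<close>
      depends on all the witnesses, it had to be secured for every isometry in advance.\<close>
    have head: "block_isometry n C w \<Longrightarrow>
        norm (blinfun_apply (chi (far (r K) y)) (blinfun_apply (\<Phi> w) (proj (blocks {..<K}) (delta y)))) \<le> e / 8" for C w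
      using good[of K] unfolding good_def by blast
    have tail: "norm (blinfun_apply (chi (far (r K) y)) (blinfun_apply (\<Phi> w) (proj (blocks {L K..}) (delta y)))) \<le> e / 8"
      if "block_isometry n C w" for C w
      by (rule order_trans[OF norm_chi_le order_trans[OF norm_block_isometry_le[OF that] g(4)]])
    have "(\<lambda>k. a k * dproj n (blocks {K..<L K}) k) = (\<lambda>k. v k * dproj n (blocks {K..<L K}) k)"
    proof
      fix k
      show "a k * dproj n (blocks {K..<L K}) k = v k * dproj n (blocks {K..<L K}) k"
      proof (cases "k \<in> {K..<L K}")
        case True
        then have "a k = v k"
          using idx[of j k] by (simp add: a_def v_def K_def M)
        then show ?thesis by simp
      next
        case False
        then have "dproj n (blocks {K..<L K}) k = 0\<^sub>m (n k) (n k)"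
          unfolding dproj_blocks by (rule if_not_P)
        then show ?thesis
          using block_isometry_carrier[OF a, of k] block_isometry_carrier[OF g(2), of k]
          by simp
      qed
    qed
    then have mid: "blinfun_apply (\<Phi> a) (proj (blocks {K..<L K}) f) = blinfun_apply (\<Phi> v) (proj (blocks {K..<L K}) f)" for f
      unfolding Phi_proj[OF block_isometry_mprod[OF a]] Phi_proj[OF block_isometry_mprod[OF g(2)]] by simp
    let ?h = "blinfun_apply (chi (far (r K) y))"
    define p where "p = ?h (blinfun_apply (\<Phi> a) (proj (blocks {..<K}) (delta y)))"
    define p' where "p' = ?h (blinfun_apply (\<Phi> v) (proj (blocks {..<K}) (delta y)))"
    define t where "t = ?h (blinfun_apply (\<Phi> a) (proj (blocks {L K..}) (delta y)))"
    define t' where "t' = ?h (blinfun_apply (\<Phi> v) (proj (blocks {L K..}) (delta y)))"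
    define m where "m = ?h (blinfun_apply (\<Phi> v) (proj (blocks {K..<L K}) (delta y)))"
    have small: "norm p \<le> e / 8" "norm p' \<le> e / 8" "norm t \<le> e / 8" "norm t' \<le> e / 8"
      unfolding p_def p'_def t_def t'_def using head tail a g(2) by blast+
    have ha: "?h (blinfun_apply (\<Phi> a) (delta y)) = p + m + t"
      using Phi_split[OF a less_imp_le[OF g(1)], of "delta y"]
      by (simp add: p_def m_def t_def mid blinfun.add_right)
    have hv: "?h (blinfun_apply (\<Phi> v) (delta y)) = p' + m + t'"
      using Phi_split[OF g(2) less_imp_le[OF g(1)], of "delta y"]
      by (simp add: p'_def m_def t'_def blinfun.add_right)
    \<comment> \<open>The middle parts agree, so the two images differ only by the four small
      terms.\<close>
    have "p' + m + t' = (p + m + t) + ((p' - p) + (t' - t))"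
      by simp
    then have "norm (p' + m + t') \<le> norm (p + m + t) + norm ((p' - p) + (t' - t))"
      using norm_triangle_ineq by metis
    also have "norm ((p' - p) + (t' - t)) \<le> norm (p' - p) + norm (t' - t)"
      by (rule norm_triangle_ineq)
    finally have "e < norm (p + m + t) + (norm (p' - p) + norm (t' - t))"
      using g(3) unfolding hv by simp
    then have "e / 2 < norm (p + m + t)"
      using small norm_triangle_ineq4[of p' p] norm_triangle_ineq4[of t' t] by linarith
    then show ?thesis
      unfolding ha[symmetric] K_def y_def .
  qed
  \<comment> \<open>Now \<open>a\<close> is one fixed quasi-local operator, while the radii
    \<open>r (M j)\<close> are at least \<open>j\<close> and so exceed any bound.\<close>
  have "\<forall>\<^sub>F R in at_top. \<forall>x. norm (blinfun_apply (chi (far R x)) (blinfun_apply (\<Phi> a) (delta x))) \<le> e / 2"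
    using e by (intro quasi_local_far quasi_local block_isometry_mprod[OF a]) simp
  then obtain R where R: "\<And>R' x. R \<le> R' \<Longrightarrow> norm (blinfun_apply (chi (far R' x)) (blinfun_apply (\<Phi> a) (delta x))) \<le> e / 2"
    unfolding eventually_at_top_linorder by blast
  obtain j :: nat where "R \<le> real j"
    using real_arch_simple by blast
  also have "real j \<le> real (M j)"
    using M_mono strict_mono_imp_increasing by simp
  also have "\<dots> \<le> r (M j)"
    using good[of "M j"] by (simp add: good_def)
  finally show False
    using R lower[of j] by (meson not_le)
qed

section \<open>Choice of shifts and signs; smallness of the tails\<close>

lemma proj_diag_index: "proj (W \<inter> diag_index n) = proj W"
  by (simp add: proj_def dproj_diag_index)

lemma norm_proj_blocks: "finite B \<Longrightarrow> (norm (proj (blocks B) f))\<^sup>2 = (\<Sum>k\<in>B. (norm (proj (blocks {k}) f))\<^sup>2)"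
proof (induction B rule: finite_induct)
  case (insert k B)
  have "blocks (insert k B) = blocks {k} \<union> blocks B" "blocks {k} \<inter> blocks B = {}"
    using insert.hyps by (auto simp: blocks_def)
  then show ?case
    using insert norm_proj_Un[of "blocks {k}" "blocks B" f] by simp
qed (simp add: blocks_simps proj_empty)

lemma norm_proj_block: "(norm (proj (blocks {k}) f))\<^sup>2 = (\<Sum>i<n k. (norm (proj {(Suc i, k)} f))\<^sup>2)"
proof -
  have "blocks {k} \<inter> diag_index n = (\<lambda>i. (Suc i, k)) ` {..<n k}"
    by (force simp: blocks_def diag_index_def image_iff Suc_le_eq dest: gr0_implies_Suc)
  then have "proj (blocks {k}) = proj ((\<lambda>i. (Suc i, k)) ` {..<n k})"
    using proj_diag_index[of "blocks {k}"] by simp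
  then show ?thesis
    using norm_proj_sum[of "(\<lambda>i. (Suc i, k)) ` {..<n k}" f] by (simp add: sum.reindex inj_on_def)
qed

text \<open>Summed over all matrix units of the \<open>k\<close>-th block, the squared masses on the \<open>N\<close> points of \<open>B\<close>
  are at most \<open>N\<close> times that of \<open>f\<close> on this block, so one of its \<open>n k\<close> cyclic shifts carries at most a fraction \<open>1 / n k\<close> of it.\<close>

lemma exists_small_shift:
  assumes B: "finite B" "card B \<le> N" and nk: "0 < n k"
  shows "\<exists>c. (\<Sum>i<n k. (norm (blinfun_apply (chi B) (eunit k i ((i + c) mod n k) f)))\<^sup>2)
    \<le> real N / real (n k) * (norm (proj (blocks {k}) f))\<^sup>2"
proof (rule ccontr)
  let ?g = "\<lambda>i j. (norm (blinfun_apply (chi B) (eunit k i j f)))\<^sup>2"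
  let ?b = "real N / real (n k) * (norm (proj (blocks {k}) f))\<^sup>2"
  assume "\<not> ?thesis"
  then have less: "?b < (\<Sum>i<n k. ?g i ((i + c) mod n k))" for c
    by (simp add: not_le)
  have "real N * (norm (proj (blocks {k}) f))\<^sup>2 = (\<Sum>c<n k. ?b)"
    using nk by simp
  also have "\<dots> < (\<Sum>c<n k. \<Sum>i<n k. ?g i ((i + c) mod n k))"
    using nk by (intro sum_strict_mono less) auto
  also have "\<dots> = (\<Sum>i<n k. \<Sum>c<n k. ?g i ((i + c) mod n k))"
    by (rule sum.swap)
  also have "\<dots> = (\<Sum>i<n k. \<Sum>j<n k. ?g i j)"
  \<comment> \<open>For a fixed row \<open>i\<close> the roles are exchanged: letting the shift
    \<open>c\<close> vary permutes the columns.\<close>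
  proof (rule sum.cong[OF refl])
    fix i
    show "(\<Sum>c<n k. ?g i ((i + c) mod n k)) = (\<Sum>j<n k. ?g i j)"
      using sum_shift_mod[of "?g i" i "n k"] unfolding add.commute[of i] .
  qed
  also have "\<dots> = (\<Sum>i<n k. \<Sum>j<n k. \<Sum>y\<in>B. (cmod (ell2_apply (eunit k i j f) y))\<^sup>2)"
    by (simp only: norm_chi_finite[OF B(1)])
  also have "\<dots> \<le> (\<Sum>i<n k. \<Sum>j<n k. \<Sum>y\<in>B.
      (norm (proj {(Suc j, k)} f))\<^sup>2 * (norm (proj {(Suc i, k)} (delta y)))\<^sup>2)"
    unfolding power_mult_distrib[symmetric] by (intro sum_mono power_mono eunit_entry_le) auto
  also have "\<dots> = (\<Sum>i<n k. \<Sum>j<n k. (norm (proj {(Suc j, k)} f))\<^sup>2 *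
      (\<Sum>y\<in>B. (norm (proj {(Suc i, k)} (delta y)))\<^sup>2))"
    by (simp only: sum_distrib_left)
  also have "\<dots> = (norm (proj (blocks {k}) f))\<^sup>2 *
      (\<Sum>i<n k. \<Sum>y\<in>B. (norm (proj {(Suc i, k)} (delta y)))\<^sup>2)"
    unfolding norm_proj_block sum_distrib_right[symmetric] sum_distrib_left[symmetric] ..
  also have "\<dots> \<le> (norm (proj (blocks {k}) f))\<^sup>2 * real N"
  \<comment> \<open>After exchanging the sums, each point of \<open>B\<close> contributes the
    squared norm of a projection of a unit vector.\<close>
  proof (rule mult_left_mono)
    have "(\<Sum>i<n k. \<Sum>y\<in>B. (norm (proj {(Suc i, k)} (delta y)))\<^sup>2) =
        (\<Sum>y\<in>B. (norm (proj (blocks {k}) (delta y)))\<^sup>2)"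
      unfolding norm_proj_block by (rule sum.swap)
    also have "\<dots> \<le> (\<Sum>y\<in>B. 1)"
    proof (rule sum_mono)
      fix y
      have "norm (proj (blocks {k}) (delta y)) \<le> 1"
        using norm_proj_le[of "blocks {k}" "delta y"] by (simp add: norm_delta)
      then show "(norm (proj (blocks {k}) (delta y)))\<^sup>2 \<le> 1"
        by (intro power_le_one) auto
    qed
    also have "\<dots> \<le> real N"
      using B(2) by simp
    finally show "(\<Sum>i<n k. \<Sum>y\<in>B. (norm (proj {(Suc i, k)} (delta y)))\<^sup>2) \<le> real N" .
  qed simp
  finally show False
    by (simp add: mult.commute)
qed

lemma proj_finite_range_small:
  assumes finB: "\<And>x :: 'x. finite (cball x r) \<and> card (cball x r) \<le> N"
    and far: "\<And>A u x. block_isometry n A u \<Longrightarrow>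
      norm (blinfun_apply (chi (far r x)) (blinfun_apply (\<Phi> u) (delta x))) \<le> e"
    and large: "\<And>k. K \<le> k \<Longrightarrow> 0 < n k \<and> real N \<le> e\<^sup>2 * real (n k)" and e: "0 < e"
  shows "norm (proj (blocks {K..<L}) (delta x)) \<le> 2 * e"
proof -
  let ?B = "cball x r" and ?I = "SIGMA k:{K..<L}. {..<n k}"
  have "\<exists>c. \<forall>k\<in>{K..<L}.
      (\<Sum>i<n k. (norm (blinfun_apply (chi ?B) (eunit k i ((i + c k) mod n k) (delta x))))\<^sup>2)
        \<le> real N / real (n k) * (norm (proj (blocks {k}) (delta x)))\<^sup>2"
    using finB large by (intro bchoice ballI exists_small_shift) auto
  then obtain c where c: "\<And>k. k \<in> {K..<L} \<Longrightarrow>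
      (\<Sum>i<n k. (norm (blinfun_apply (chi ?B) (eunit k i ((i + c k) mod n k) (delta x))))\<^sup>2)
        \<le> real N / real (n k) * (norm (proj (blocks {k}) (delta x)))\<^sup>2"
    by blast
  define w where "w = (\<lambda>(k, i). eunit k i ((i + c k) mod n k) (delta x))"
  have "finite ?I" by simp
  then obtain s :: "nat \<times> nat \<Rightarrow> real" where s: "\<And>t. s t = 1 \<or> s t = - 1"
    "(norm (\<Sum>t\<in>?I. s t *\<^sub>R blinfun_apply (chi ?B) (w t)))\<^sup>2 \<le> (\<Sum>t\<in>?I. (norm (blinfun_apply (chi ?B) (w t)))\<^sup>2)"
    using exists_signs_norm_sum_le[of ?I "\<lambda>t. blinfun_apply (chi ?B) (w t)"] by blast
  \<comment> \<open>This \<open>u\<close> depends on \<open>x\<close> through both \<open>c\<close>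
    and \<open>s\<close>; \<open>far\<close> still applies, as its radius serves all isometries and
    points.\<close>
  define u where "u = mcomb n (shift_graph n {K..<L} c) (\<lambda>k i j. of_real (s (k, i)))"
  have u: "block_isometry n {K..<L} u"
    unfolding u_def using s(1) by (rule signed_shift_block_isometry)
  have "blinfun_apply (\<Phi> u) (delta x) = (\<Sum>t\<in>?I. s t *\<^sub>R w t)"
  proof -
    have inj: "inj_on (\<lambda>(k, i). (k, i, (i + c k) mod n k)) ?I"
      by (auto simp: inj_on_def)
    have fin: "finite (shift_graph n {K..<L} c)"
      by (simp add: shift_graph_def)
    show ?thesis
      unfolding u_def Phi_mcomb[OF fin] unfolding shift_graph_def sum.reindex[OF inj]
      by (simp add: w_def split_beta scaleC_of_real)
  qed
  then have "blinfun_apply (chi ?B) (blinfun_apply (\<Phi> u) (delta x)) =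
      (\<Sum>t\<in>?I. s t *\<^sub>R blinfun_apply (chi ?B) (w t))"
    by (simp add: blinfun.sum_right blinfun.scaleR_right)
  then have "(norm (blinfun_apply (chi ?B) (blinfun_apply (\<Phi> u) (delta x))))\<^sup>2
      \<le> (\<Sum>t\<in>?I. (norm (blinfun_apply (chi ?B) (w t)))\<^sup>2)"
    using s(2) by simp
  also have "\<dots> = (\<Sum>k\<in>{K..<L}. \<Sum>i<n k. (norm (blinfun_apply (chi ?B) (w (k, i))))\<^sup>2)"
    by (subst sum.Sigma) (simp_all add: split_beta)
  also have "\<dots> \<le> (\<Sum>k\<in>{K..<L}. e\<^sup>2 * (norm (proj (blocks {k}) (delta x)))\<^sup>2)"
  proof (rule sum_mono)
    fix k assume k: "k \<in> {K..<L}"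
    \<comment> \<open>The block size beats the cardinality of the ball, so the share left inside is
      at most \<open>e\<^sup>2\<close> in every block.\<close>
    then have "real N / real (n k) \<le> e\<^sup>2"
      using large[of k] by (simp add: divide_le_eq)
    then have "real N / real (n k) * (norm (proj (blocks {k}) (delta x)))\<^sup>2
        \<le> e\<^sup>2 * (norm (proj (blocks {k}) (delta x)))\<^sup>2"
      by (rule mult_right_mono) simp
    then show "(\<Sum>i<n k. (norm (blinfun_apply (chi ?B) (w (k, i))))\<^sup>2)
        \<le> e\<^sup>2 * (norm (proj (blocks {k}) (delta x)))\<^sup>2"
      using c[OF k] by (simp add: w_def)
  qed
  also have "\<dots> = e\<^sup>2 * (norm (proj (blocks {K..<L}) (delta x)))\<^sup>2"
    unfolding norm_proj_blocks[OF finite_atLeastLessThan[of K L]] by (rule sum_distrib_left[symmetric])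
  also have "\<dots> \<le> e\<^sup>2 * 1\<^sup>2"
    using norm_proj_le[of "blocks {K..<L}" "delta x"] by (intro mult_left_mono power_mono) (auto simp: norm_delta)
  finally have near: "norm (blinfun_apply (chi ?B) (blinfun_apply (\<Phi> u) (delta x))) \<le> e"
    using e by (simp add: power_mono_iff)
  have "- ?B = far r x"
    by (auto simp: far_def)
  have "norm (proj (blocks {K..<L}) (delta x)) = norm (blinfun_apply (\<Phi> u) (delta x))"
    by (rule norm_block_isometry[OF u, symmetric])
  also have "\<dots> \<le> norm (blinfun_apply (chi ?B) (blinfun_apply (\<Phi> u) (delta x)))
      + norm (blinfun_apply (chi (- ?B)) (blinfun_apply (\<Phi> u) (delta x)))"
    using norm_triangle_ineq[of "blinfun_apply (chi ?B) (blinfun_apply (\<Phi> u) (delta x))"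
        "blinfun_apply (chi (- ?B)) (blinfun_apply (\<Phi> u) (delta x))"]
    unfolding chi_Compl .
  also have "\<dots> \<le> 2 * e"
    using near far[OF u, of x] unfolding \<open>- ?B = far r x\<close> by simp
  finally show ?thesis .
qed

text \<open>The choices are made in the order \<open>r\<close>, \<open>N\<close>, \<open>m\<close>,
  \<open>K\<close>, each from \<open>e\<close> and the preceding ones, and none of them sees
  \<open>x\<close>.\<close>

lemma proj_tail_uniformly_small:
  assumes ulf: "uniformly_locally_finite TYPE('x)" and n: "filterlim n at_top sequentially"
    and e: "0 < e"
  shows "\<exists>K. \<forall>x :: 'x. norm (proj (blocks {K..}) (delta x)) \<le> 2 * e"
proof -
  obtain r where r: "0 < r" and far: "\<And>A u x. block_isometry n A u \<Longrightarrow>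
      norm (blinfun_apply (chi (far r x)) (blinfun_apply (\<Phi> u) (delta x))) \<le> e"
    using uniformly_quasi_local[OF e] by blast
  obtain N where N: "\<And>x :: 'x. finite (cball x r) \<and> card (cball x r) \<le> N"
    using ulf r unfolding uniformly_locally_finite_def by blast
  obtain m :: nat where m: "real N / e\<^sup>2 \<le> real m"
    using real_arch_simple by blast
  \<comment> \<open>Taking \<open>Suc m\<close> in place of \<open>m\<close> also secures
    \<open>0 < n k\<close>.\<close>
  have "\<forall>\<^sub>F k in sequentially. Suc m \<le> n k"
    using n unfolding filterlim_at_top by blast
  then obtain K where K: "\<And>k. K \<le> k \<Longrightarrow> Suc m \<le> n k"
    unfolding eventually_sequentially by blast
  have large: "0 < n k \<and> real N \<le> e\<^sup>2 * real (n k)" if "K \<le> k" for k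
  proof -
    have "real N / e\<^sup>2 \<le> real (n k)"
      using m K[OF that] by linarith
    then show ?thesis
      using K[OF that] e by (simp add: divide_le_eq mult.commute)
  qed
  have "norm (proj (blocks {K..}) (delta x)) \<le> 2 * e" for x
  \<comment> \<open>The bound for \<open>{K..<L}\<close> is the same for every \<open>L\<close>, and
    for fixed \<open>x\<close> the remaining tail vanishes as \<open>L\<close> grows, at a rate that
    may depend on \<open>x\<close>.\<close>
  proof (rule LIMSEQ_le_const)
    show "(\<lambda>L. 2 * e + norm (proj (blocks {L..}) (delta x))) \<longlonglongrightarrow> 2 * e"
      using tendsto_add[OF tendsto_const proj_tail_tendsto[of "delta x"]] by simp
    have "norm (proj (blocks {K..}) (delta x)) \<le> 2 * e + norm (proj (blocks {L..}) (delta x))"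
      if "K \<le> L" for L
    proof -
      have "blocks {K..} = blocks {K..<L} \<union> blocks {L..}" "blocks {K..<L} \<inter> blocks {L..} = {}"
        using that by (auto simp: blocks_def)
      then have "proj (blocks {K..}) (delta x) = proj (blocks {K..<L}) (delta x) + proj (blocks {L..}) (delta x)"
        by (metis proj_Un)
      moreover have "norm (proj (blocks {K..<L}) (delta x)) \<le> 2 * e"
        by (rule proj_finite_range_small[OF N far large e])
      ultimately show ?thesis
        using norm_triangle_ineq[of "proj (blocks {K..<L}) (delta x)" "proj (blocks {L..}) (delta x)"]
        by simp
    qed
    then show "\<exists>M. \<forall>L\<ge>M. norm (proj (blocks {K..}) (delta x)) \<le> 2 * e + norm (proj (blocks {L..}) (delta x))"
      by blast
  qed
  then show ?thesis by blast
qed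

section \<open>Strong summation of the diagonal units\<close>

lemma proj_tail_has_sum:
  "((\<lambda>s. proj {s} f) has_sum proj (blocks {K..}) f) (diag_index n \<inter> blocks {K..})"
  unfolding has_sum_def
proof (rule tendstoI)
  fix e :: real assume "0 < e"
  then have "\<forall>\<^sub>F L in sequentially. norm (proj (blocks {L..}) f) < e"
    by (rule order_tendstoD(2)[OF proj_tail_tendsto])
  then obtain L where L: "norm (proj (blocks {L..}) f) < e"
    using eventually_happens'[OF sequentially_bot] by blast
  let ?X = "diag_index n \<inter> blocks {K..<L}"
  have "?X \<subseteq> (\<Union>k<L. {..n k} \<times> {k})"
    by (auto simp: diag_index_def blocks_def)
  then have "finite ?X"
    by (rule finite_subset) simp
  moreover have "dist (\<Sum>s\<in>Y. proj {s} f) (proj (blocks {K..}) f) < e"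
    if Y: "finite Y" "?X \<subseteq> Y" "Y \<subseteq> diag_index n \<inter> blocks {K..}" for Y
  proof -
    have "Y \<union> (blocks {K..} - Y) = blocks {K..}"
      using Y(3) by blast
    then have "proj (blocks {K..}) f = (\<Sum>s\<in>Y. proj {s} f) + proj (blocks {K..} - Y) f"
      using proj_Un[of Y "blocks {K..} - Y" f] by (simp add: proj_sum[OF Y(1)])
    then have "dist (\<Sum>s\<in>Y. proj {s} f) (proj (blocks {K..}) f) = norm (proj (blocks {K..} - Y) f)"
      by (simp add: dist_norm)
    \<comment> \<open>Only after the surplus pairs are discarded does the complement of
      \<open>Y\<close> lie beyond block \<open>L\<close>.\<close>
    also have "\<dots> = norm (proj ((blocks {K..} - Y) \<inter> diag_index n) f)"
      by (simp add: proj_diag_index)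
    also have "\<dots> \<le> norm (proj (blocks {L..}) f)"
      using Y(2) by (intro norm_proj_mono) (auto simp: blocks_def)
    finally show ?thesis using L by simp
  qed
  moreover have "?X \<subseteq> diag_index n \<inter> blocks {K..}"
    by (auto simp: blocks_def)
  ultimately show "\<forall>\<^sub>F Y in finite_subsets_at_top (diag_index n \<inter> blocks {K..}).
      dist (\<Sum>s\<in>Y. proj {s} f) (proj (blocks {K..}) f) < e"
    unfolding eventually_finite_subsets_at_top by blast
qed

end

theorem theorem5p9:
  fixes n :: "nat \<Rightarrow> nat"
    and \<Phi> :: "(nat \<Rightarrow> complex mat) \<Rightarrow> ('x::metric_space ell2 \<Rightarrow>\<^sub>L 'x ell2)"
    and S :: "(nat \<times> nat) set"
    and q :: "nat \<times> nat \<Rightarrow> ('x ell2 \<Rightarrow>\<^sub>L 'x ell2)"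
  assumes "uniformly_locally_finite TYPE('x)"
    and "filterlim n at_top sequentially"
    and "normal_embedding n \<Phi>"
    and "S = {(i, k). 1 \<le> i \<and> i \<le> n k}"
    and "\<And>i k. (i, k) \<in> S \<Longrightarrow> q (i, k) = \<Phi> (munit n k i i)"
  shows "asymptotically_ghost S q"
proof -
  interpret normal_block_embedding n \<Phi>
    using assms(3) by unfold_locales
  have S: "S = diag_index n"
    by (simp add: assms(4) diag_index_def)
  have q: "q s = \<Phi> (dproj n {s})" if mem: "s \<in> S" for s
  proof -
    obtain i k where s: "s = (Suc i, k)"
      using mem unfolding assms(4) by (cases s; cases "fst s") auto
    show ?thesis
      using assms(5)[of "Suc i" k] mem by (simp add: s munit_dproj)
  qed
  have apply_q: "blinfun_apply (q s) f = proj {s} f" if "s \<in> S" for s f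
    by (simp add: q[OF that] proj_def)
  have "orthogonal_projections S q"
    unfolding orthogonal_projections_def
  proof (intro conjI ballI impI)
    fix s assume s: "s \<in> S"
    show "projection_op (q s)"
      unfolding projection_op_def is_adjoint_def apply_q[OF s]
      by (simp add: q[OF s] Phi_bounded dproj_mprod Phi_dproj_comp proj_adjoint)
    fix t assume t: "t \<in> S" and "s \<noteq> t"
    then show "q s o\<^sub>L q t = 0"
      by (simp add: q[OF s] q[OF t] Phi_dproj_comp Phi_dproj_empty)
  qed
  moreover have "\<exists>F T. finite F \<and> finite T \<and> T \<subseteq> S \<and> (\<forall>x. x \<notin> F \<longrightarrow>
      (\<exists>v. ((\<lambda>s. blinfun_apply (q s) (delta x)) has_sum v) (S - T) \<and> norm v < \<epsilon>))"
    if pos: "0 < \<epsilon>" for \<epsilon> :: real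
  proof -
    \<comment> \<open>Two thirds of \<open>\<epsilon>\<close> leave room for the strict
      inequality.\<close>
    obtain K where K: "\<And>x :: 'x. norm (proj (blocks {K..}) (delta x)) \<le> 2 * (\<epsilon> / 3)"
      using proj_tail_uniformly_small[OF assms(1,2), of "\<epsilon> / 3"] pos by auto
    let ?T = "S \<inter> blocks {..<K}"
    have "?T \<subseteq> (\<Union>k<K. {..n k} \<times> {k})"
      by (auto simp: assms(4) blocks_def)
    then have "finite ?T"
      by (rule finite_subset) simp
    moreover have "S - ?T = diag_index n \<inter> blocks {K..}"
      by (auto simp: S blocks_def)
    moreover have "((\<lambda>s. blinfun_apply (q s) (delta x)) has_sum proj (blocks {K..}) (delta x))
        (diag_index n \<inter> blocks {K..})" for x
      using proj_tail_has_sum[of "delta x" K]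
      by (rule has_sum_cong[THEN iffD1, rotated]) (simp add: apply_q S)
    moreover have "norm (proj (blocks {K..}) (delta x)) < \<epsilon>" for x :: 'x
      using K[of x] pos by simp
    \<comment> \<open>The estimate holds at every point, so the exceptional set of points is empty;
      the finite set \<open>T\<close> absorbs the blocks below \<open>K\<close>.\<close>
    ultimately show ?thesis
      by (intro exI[of _ "{}"] exI[of _ ?T]) auto
  qed
  ultimately show ?thesis
    unfolding asymptotically_ghost_def by blast
qed

end
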